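(* Let $n\ge2$. The map $\rho^{\otimes n}:\mathbf{A}\to\operatorname{Mat}_n(H)[\tau]$ defined in the context is an ($n$-dimensional) Anderson $\mathbf{A}$-module.
   Context: Setting. Let $q$ be a prime power and $E/\mathbb{F}_q$ an elliptic curve $y^2+c_1ty+c_3y=t^3+c_2t^2+c_4t+c_6$, $c_i\in\mathbb{F}_q$, with point at infinity $\infty$; $\mathbf{A}=\mathbb{F}_q[t,y]$. Let $\theta,\eta$ be independent elements satisfying the same equation, $A=\mathbb{F}_q[\theta,\eta]$, $K=\mathbb{F}_q(\theta,\eta)$, $\iota:\mathbf{A}\to A$ the isomorphism $t\mapsto\theta$, $y\mapsto\eta$. On $K$ let $\deg=-\operatorname{ord}_\infty$ with $\deg\theta=2,\deg\eta=3$; $K_\infty$ is the completion and $\mathbb{C}_\infty$ the completion of an algebraic closure of $K_\infty$. $\Xi=(\theta,\eta)\in E(K)$. Twisting $g\mapsto g^{(1)}$ raises coefficients in $\mathbb{C}_\infty$ to the $q$-th power and fixes $t,y$; it acts on matrices entrywise and on points by $q$-Frobenius on coordinates; $(i)$ denotes the $i$-th iterate. The sign of $g\in\mathbb{C}_\infty[t,y]$ is its leading coefficient (by pole order at $\infty$) in the basis $t^i,t^jy$, extended multiplicatively. $H\subset K_\infty$ is the Hilbert class field of $K$; $V\in E(H)$ is the unique point with coordinates of positive degree with $V-V^{(1)}=\Xi$. $f\in H(t,y)$ has sign 1 and $\operatorname{div}(f)=(V^{(1)})-(V)+(\Xi)-(\infty)$. For $1\le j\le n$, $g_j\in H(t,y)$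 has sign 1 and $\operatorname{div}(g_j)=-n(V)+(n-j)(\infty)+(j-1)(\Xi)+([j-1]V^{(1)}+[n-(j-1)]V)$. For $i=jn+k$, $1\le k\le n$, $j\ge1$, put $g_i=(ff^{(1)}\cdots f^{(j-1)})^ng_k^{(j)}$. Let $a_i,y_i,z_i\in H$ ($1\le i\le n$) be the constants with $tg_i=\theta g_i+a_ig_{i+1}+g_{i+2}$ and $yg_i=\eta g_i+y_ig_{i+1}+z_ig_{i+2}+g_{i+3}$. $\operatorname{Mat}_n(H)[\tau]$ is the twisted polynomial ring with $\tau B=B^{(1)}\tau$. Define $\rho_t^{\otimes n}=d[\theta]+E_\theta\tau$, where $d[\theta]$ has $\theta$ on the diagonal, $a_1,\dots,a_{n-1}$ on the first superdiagonal, $1$'s on the second superdiagonal, zeros elsewhere, and $E_\theta$ is zero except for its last two rows $(1,0,\dots,0)$, $(a_n,1,0,\dots,0)$. Define $\rho_y^{\otimes n}=d[\eta]+E_\eta\tau$, where $d[\eta]$ has $\eta$ on the diagonal, $y_1,\dots,y_{n-1}$ on the first, $z_1,\dots,z_{n-2}$ on the second, and $1$'s on the third superdiagonal, zeros elsewhere, and $E_\eta$ is zero except for its last three rows $(1,0,\dots,0)$, $(z_{n-1},1,0,\dots,0)$, $(y_n,z_n,1,0,\dots,0)$. For $a=\sum c_it^i+y\sum d_it^i\in\mathbf{A}$ with $c_i,d_i\in\mathbb{F}_q$, set $\rho_a^{\otimes n}=\sum c_i(\rho_t^{\otimes n})^i+\rho_y^{\otimes n}\sum d_i(\rho_t^{\otimes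 n})^i$; a priori this is only an $\mathbb{F}_q$-linear map. An $n$-dimensional Anderson $\mathbf{A}$-module is an $\mathbb{F}_q$-algebra homomorphism $\rho:\mathbf{A}\to\operatorname{Mat}_n(L)[\tau]$ ($L$ an algebraically closed field containing $H$, here $L=\mathbb{C}_\infty$) such that for every $a\in\mathbf{A}$, $\rho_a=d[a]+A_1\tau+\dots+A_m\tau^m$ with $d[a]=\iota(a)I+N$ for some nilpotent matrix $N\in\operatorname{Mat}_n(L)$.
   Formalization: For n=2 the three displayed rows of E_η do not fit a 2×2 matrix (and truncating them makes the claim false), so there ρ_y^{⊗2} is taken to be d[η]+E_ητ plus a τ² term whose only nonzero entry is a 1 in row 2, column 1; for n≥3 the map is as defined. *)

theory Defs
  imports
    "HOL-Analysis.Elementary_Metric_Spaces"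
    "HOL-Library.Poly_Mapping"
    "HOL-Algebra.Algebraic_Closure_Type"
    "HOL-Algebra.Generated_Fields"
    "Jordan_Normal_Form.Matrix"
begin

section \<open>Fields and discrete valuations\<close>

text \<open>Subfields and subrings of a type of class field are treated with the carrier-based
  library, applied to the whole type.\<close>

abbreviation univ_field :: "'a::field ring" where
  "univ_field \<equiv> ring_of_type_algebra"

abbreviation restrict_ring :: "'a::field set \<Rightarrow> 'a ring" where
  "restrict_ring S \<equiv> univ_field\<lparr>carrier := S\<rparr>"

text \<open>A normalized discrete valuation of the subfield \<open>L\<close>; the value at 0 (morally
  infinity) is left unspecified.\<close>

definition normalized_valuation :: "'a::field set \<Rightarrow> ('a \<Rightarrow> int) \<Rightarrow> bool" where
  "normalized_valuation L w \<longleftrightarrow>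
     (\<forall>x\<in>L - {0}. \<forall>y\<in>L - {0}. w (x * y) = w x + w y) \<and>
     (\<forall>x\<in>L - {0}. \<forall>y\<in>L - {0}. x + y \<noteq> 0 \<longrightarrow> min (w x) (w y) \<le> w (x + y)) \<and>
     (\<exists>x\<in>L - {0}. w x = 1)"

definition automorphisms_over :: "'a::field set \<Rightarrow> 'a set \<Rightarrow> ('a \<Rightarrow> 'a) set" where
  "automorphisms_over K L =
     {s \<in> ring_iso (restrict_ring L) (restrict_ring L). \<forall>x\<in>K. s x = x}"

text \<open>Finite Galois (\<open>K\<close> is the fixed field of the automorphisms) with commutative group.\<close>

definition finite_abelian_extension :: "'a::field set \<Rightarrow> 'a set \<Rightarrow> bool" where
  "finite_abelian_extension K L \<longleftrightarrow>
     subfield K univ_field \<and> subfield L univ_field \<and> K \<subseteq> L \<and>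
     ring.finite_dimension univ_field K L \<and>
     {x \<in> L. \<forall>s\<in>automorphisms_over K L. s x = x} = K \<and>
     (\<forall>s\<in>automorphisms_over K L. \<forall>s'\<in>automorphisms_over K L. \<forall>x\<in>L. s (s' x) = s' (s x))"

text \<open>Ramification index 1 at every place of \<open>L\<close>, including those above infinity. This is the
  full condition for function fields over a finite field: the residue fields are finite, so
  residue extensions are separable, and valuations are trivial on constants.\<close>

definition unramified_everywhere :: "'a::field set \<Rightarrow> 'a set \<Rightarrow> bool" where
  "unramified_everywhere K L \<longleftrightarrow>
     (\<forall>w. normalized_valuation L w \<longrightarrow> (\<exists>x\<in>K - {0}. w x = 1))"

text \<open>The Hilbert class field of \<open>K\<close> (relative to the place infinity): the largest unramified
  abelian extension in which infinity splits completely. For a Galois extension, splitting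
  completely at infinity means being contained in the completion \<open>Kinf\<close>.\<close>

definition is_hilbert_class_field :: "'a::field set \<Rightarrow> 'a set \<Rightarrow> 'a set \<Rightarrow> bool" where
  "is_hilbert_class_field K Kinf H \<longleftrightarrow>
     finite_abelian_extension K H \<and> unramified_everywhere K H \<and> H \<subseteq> Kinf \<and>
     (\<forall>L. finite_abelian_extension K L \<and> unramified_everywhere K L \<and> L \<subseteq> Kinf \<longrightarrow> L \<subseteq> H)"

section \<open>Weierstrass curves and their group law\<close>

datatype 'a weierstrass = Weierstrass (c1: 'a) (c2: 'a) (c3: 'a) (c4: 'a) (c6: 'a)

definition weierstrass_eq :: "'a::field weierstrass \<Rightarrow> 'a \<Rightarrow> 'a \<Rightarrow> bool" where
  "weierstrass_eq E x y \<longleftrightarrow>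
     y^2 + c1 E * x * y + c3 E * y = x^3 + c2 E * x^2 + c4 E * x + c6 E"

text \<open>Smoothness at every affine point over the ambient field, which will be algebraically
  closed (the point at infinity is always smooth).\<close>

definition nonsingular_curve :: "'a::field weierstrass \<Rightarrow> bool" where
  "nonsingular_curve E \<longleftrightarrow>
     (\<forall>x y. weierstrass_eq E x y \<longrightarrow>
        2 * y + c1 E * x + c3 E \<noteq> 0 \<or> c1 E * y - (3 * x^2 + 2 * c2 E * x + c4 E) \<noteq> 0)"

datatype 'a point = Infinity | Affine 'a 'a

definition curve_points :: "'a::field weierstrass \<Rightarrow> 'a point set" where
  "curve_points E = {Infinity} \<union> {Affine x y | x y. weierstrass_eq E x y}"

fun point_neg :: "'a::field weierstrass \<Rightarrow> 'a point \<Rightarrow> 'a point" where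
  "point_neg E Infinity = Infinity"
| "point_neg E (Affine x y) = Affine x (- y - c1 E * x - c3 E)"

fun point_add :: "'a::field weierstrass \<Rightarrow> 'a point \<Rightarrow> 'a point \<Rightarrow> 'a point" where
  "point_add E Infinity Q = Q"
| "point_add E P Infinity = P"
| "point_add E (Affine x1 y1) (Affine x2 y2) =
     (if x1 = x2 \<and> y1 + y2 + c1 E * x2 + c3 E = 0 then Infinity
      else let l = (if x1 \<noteq> x2 then (y2 - y1) / (x2 - x1)
                    else (3 * x1^2 + 2 * c2 E * x1 + c4 E - c1 E * y1) /
                         (2 * y1 + c1 E * x1 + c3 E));
               x3 = l^2 + c1 E * l - c2 E - x1 - x2
           in Affine x3 (- (l + c1 E) * x3 - (y1 - l * x1) - c3 E))"

definition point_mult :: "'a::field weierstrass \<Rightarrow> nat \<Rightarrow> 'a point \<Rightarrow> 'a point" where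
  "point_mult E m P = (point_add E P ^^ m) Infinity"

fun frobenius_point :: "nat \<Rightarrow> 'a::field point \<Rightarrow> 'a point" where
  "frobenius_point q Infinity = Infinity"
| "frobenius_point q (Affine x y) = Affine (x ^ q) (y ^ q)"

section \<open>The fields \<open>K\<close>, \<open>K\<^sub>\<infinity>\<close> and \<open>C\<^sub>\<infinity>\<close>\<close>

text \<open>The absolute value of \<open>C\<^sub>\<infinity>\<close> is the distance to 0, and its logarithm to base \<open>q\<close>
  is the degree.\<close>

definition inf_deg :: "nat \<Rightarrow> 'c::{field,metric_space} \<Rightarrow> real" where
  "inf_deg q x = log (real q) (dist x 0)"

text \<open>The type \<open>'c\<close> is \<open>C\<^sub>\<infinity>\<close>: a complete algebraically closed field, with a non-archimedean
  multiplicative absolute value, in which the elements algebraic over \<open>K\<^sub>\<infinity>\<close> (the closure of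
  \<open>K = F\<^sub>q(\<theta>,\<eta>)\<close>) are dense. The two degree conditions determine the absolute value on \<open>K\<close>: it
  is trivial on the finite field \<open>Fq\<close>, and the \<open>Fq\<close>-basis \<open>\<theta>\<^sup>i, \<theta>\<^sup>j\<eta>\<close> of the ring \<open>F\<^sub>q[\<theta>,\<eta>]\<close> has
  pairwise distinct degrees \<open>2i, 2j+3\<close>, so the degree is minus the order at infinity.
  A finite field has prime power order, so this need not be required of \<open>q\<close>.\<close>

locale elliptic_base =
  fixes q :: nat and Fq :: "'c::{alg_closed_field,complete_space} set"
    and E :: "'c weierstrass" and \<theta> \<eta> :: 'c
  assumes Fq_subfield: "subfield Fq univ_field"
    and Fq_finite: "finite Fq" and Fq_card: "card Fq = q"
    and E_over_Fq: "set_weierstrass E \<subseteq> Fq"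
    and E_nonsingular: "nonsingular_curve E"
    and \<theta>_transcendental: "ring.transcendental univ_field Fq \<theta>"
    and \<theta>_\<eta>_eq: "weierstrass_eq E \<theta> \<eta>"
    and dist_translation: "dist x y = dist (x - y) (0::'c)"
    and abs_mult: "dist (x * y) 0 = dist x 0 * dist y (0::'c)"
    and abs_ultrametric: "dist (x + y) 0 \<le> max (dist x 0) (dist y (0::'c))"
    and deg_\<theta>: "inf_deg q \<theta> = 2"
    and deg_\<eta>: "inf_deg q \<eta> = 3"
    and algebraic_dense:
      "closure {x. \<not> ring.transcendental univ_field
                      (closure (generate_field univ_field (Fq \<union> {\<theta>, \<eta>}))) x} = UNIV"

section \<open>The function field \<open>C\<^sub>\<infinity>(t,y)\<close>\<close>

text \<open>The type \<open>'f\<close> is the function field of \<open>E\<close> over \<open>'c\<close>; \<open>\<kappa>\<close> embeds the constants, and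
  \<open>tw\<close> is the first twist (the ring homomorphism fixing \<open>t, y\<close> and acting on constants
  by \<open>c \<mapsto> c^q\<close>), which is determined by these properties.\<close>

locale elliptic_function_field =
  fixes q :: nat and E :: "'c::field weierstrass"
    and \<kappa> :: "'c \<Rightarrow> 'f::field" and t y :: 'f and tw :: "'f \<Rightarrow> 'f"
  assumes \<kappa>_hom: "\<kappa> \<in> Ring.ring_hom univ_field univ_field"
    and t_transcendental: "ring.transcendental univ_field (range \<kappa>) t"
    and t_y_eq: "weierstrass_eq (map_weierstrass \<kappa> E) t y"
    and generated: "generate_field univ_field (range \<kappa> \<union> {t, y}) = UNIV"
    and tw_hom: "tw \<in> Ring.ring_hom univ_field univ_field"
    and tw_const: "tw (\<kappa> c) = \<kappa> (c ^ q)"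
    and tw_t: "tw t = t"
    and tw_y: "tw y = y"

text \<open>\<open>w\<close> is the order of vanishing at the point \<open>P\<close>: the normalized valuation that is trivial
  on constants and whose centre is \<open>P\<close>.\<close>

definition is_order_at ::
    "('c::field \<Rightarrow> 'f::field) \<Rightarrow> 'f \<Rightarrow> 'f \<Rightarrow> 'c point \<Rightarrow> ('f \<Rightarrow> int) \<Rightarrow> bool" where
  "is_order_at \<kappa> t y P w \<longleftrightarrow>
     normalized_valuation UNIV w \<and> (\<forall>c. c \<noteq> 0 \<longrightarrow> w (\<kappa> c) = 0) \<and>
     (case P of
        Infinity \<Rightarrow> w t < 0 \<and> w y < 0
      | Affine x0 y0 \<Rightarrow> w (t - \<kappa> x0) > 0 \<and> w (y - \<kappa> y0) > 0)"

definition has_divisor ::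
    "'c::field weierstrass \<Rightarrow> ('c \<Rightarrow> 'f::field) \<Rightarrow> 'f \<Rightarrow> 'f \<Rightarrow> 'f \<Rightarrow> ('c point \<Rightarrow>\<^sub>0 int) \<Rightarrow> bool"
  where
  "has_divisor E \<kappa> t y g D \<longleftrightarrow>
     g \<noteq> 0 \<and> Poly_Mapping.keys D \<subseteq> curve_points E \<and>
     (\<forall>P\<in>curve_points E. \<exists>w. is_order_at \<kappa> t y P w \<and> w g = Poly_Mapping.lookup D P)"

abbreviation div_pt :: "'c point \<Rightarrow> int \<Rightarrow> ('c point \<Rightarrow>\<^sub>0 int)" where
  "div_pt \<equiv> Poly_Mapping.single"

definition regular_fun ::
    "('c::field \<Rightarrow> 'f::field) \<Rightarrow> 'f \<Rightarrow> 'f \<Rightarrow> 'c poly \<Rightarrow> 'c poly \<Rightarrow> 'f" where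
  "regular_fun \<kappa> t y c d = poly (map_poly \<kappa> c) t + y * poly (map_poly \<kappa> d) t"

text \<open>Leading coefficient of \<open>c(t) + y d(t)\<close>, where \<open>t\<close> and \<open>y\<close> have pole orders 2 and 3.\<close>

definition regular_sign :: "'c::field poly \<Rightarrow> 'c poly \<Rightarrow> 'c" where
  "regular_sign c d =
     (if d \<noteq> 0 \<and> 2 * Polynomial.degree c < 2 * Polynomial.degree d + 3
      then Polynomial.lead_coeff d else Polynomial.lead_coeff c)"

definition has_sign :: "('c::field \<Rightarrow> 'f::field) \<Rightarrow> 'f \<Rightarrow> 'f \<Rightarrow> 'f \<Rightarrow> 'c \<Rightarrow> bool" where
  "has_sign \<kappa> t y g s \<longleftrightarrow>
     (\<exists>c d c' d'. regular_fun \<kappa> t y c d \<noteq> 0 \<and> regular_fun \<kappa> t y c' d' \<noteq> 0 \<and>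
        g = regular_fun \<kappa> t y c d / regular_fun \<kappa> t y c' d' \<and>
        s = regular_sign c d / regular_sign c' d')"

text \<open>For \<open>a\<close> in \<open>F\<^sub>q[t,y]\<close>, the unique pair \<open>(c,d)\<close> of polynomials over \<open>Fq\<close> with
  \<open>a = c(t) + y d(t)\<close>.\<close>

definition A_coords ::
    "'c::field set \<Rightarrow> ('c \<Rightarrow> 'f::field) \<Rightarrow> 'f \<Rightarrow> 'f \<Rightarrow> 'f \<Rightarrow> 'c poly \<times> 'c poly" where
  "A_coords Fq \<kappa> t y a =
     (THE (c, d). set (coeffs c) \<subseteq> Fq \<and> set (coeffs d) \<subseteq> Fq \<and> a = regular_fun \<kappa> t y c d)"

definition A_ring :: "'c::field set \<Rightarrow> ('c \<Rightarrow> 'f::field) \<Rightarrow> 'f \<Rightarrow> 'f \<Rightarrow> 'f set" where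
  "A_ring Fq \<kappa> t y = generate_ring univ_field (\<kappa> ` Fq \<union> {t, y})"

text \<open>The isomorphism \<open>F\<^sub>q[t,y] \<rightarrow> F\<^sub>q[\<theta>,\<eta>]\<close> with \<open>t \<mapsto> \<theta>\<close> and \<open>y \<mapsto> \<eta>\<close>.\<close>

definition iota ::
    "'c::field set \<Rightarrow> 'c \<Rightarrow> 'c \<Rightarrow> ('c \<Rightarrow> 'f::field) \<Rightarrow> 'f \<Rightarrow> 'f \<Rightarrow> 'f \<Rightarrow> 'c" where
  "iota Fq \<theta> \<eta> \<kappa> t y a = (case A_coords Fq \<kappa> t y a of (c, d) \<Rightarrow> poly c \<theta> + \<eta> * poly d \<theta>)"

section \<open>Twisted polynomials and Anderson modules\<close>

text \<open>\<open>Mat\<^sub>n(S)[\<tau>]\<close> for a subfield \<open>S\<close>: an element is its sequence of coefficients, and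
  \<open>\<tau> B = B^(1) \<tau>\<close> forces the twist \<open>B \<mapsto> B^(i)\<close> in the product.\<close>

definition twist_mat :: "nat \<Rightarrow> nat \<Rightarrow> 'c::field mat \<Rightarrow> 'c mat" where
  "twist_mat q i B = map_mat (\<lambda>x. x ^ (q ^ i)) B"

definition twisted_poly_ring :: "nat \<Rightarrow> nat \<Rightarrow> 'c::field set \<Rightarrow> (nat \<Rightarrow> 'c mat) ring" where
  "twisted_poly_ring q n S = \<lparr>
     carrier = {P. (\<forall>i. P i \<in> carrier_mat n n \<and> elements_mat (P i) \<subseteq> S) \<and>
                   finite {i. P i \<noteq> 0\<^sub>m n n}},
     monoid.mult = (\<lambda>P Q k. mat n n (\<lambda>(r, s). \<Sum>i\<le>k. (P i * twist_mat q i (Q (k - i))) $$ (r, s))),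
     one = (\<lambda>i. if i = 0 then 1\<^sub>m n else 0\<^sub>m n n),
     ring.zero = (\<lambda>_. 0\<^sub>m n n),
     add = (\<lambda>P Q i. P i + Q i) \<rparr>"

definition scalar_tp :: "nat \<Rightarrow> 'c::field \<Rightarrow> nat \<Rightarrow> 'c mat" where
  "scalar_tp n c = (\<lambda>i. if i = 0 then c \<cdot>\<^sub>m 1\<^sub>m n else 0\<^sub>m n n)"

definition nilpotent_mat :: "nat \<Rightarrow> 'c::field mat \<Rightarrow> bool" where
  "nilpotent_mat n N \<longleftrightarrow> N \<in> carrier_mat n n \<and> (\<exists>k. N ^\<^sub>m k = 0\<^sub>m n n)"

text \<open>The coefficient field \<open>L\<close> is the whole algebraically closed type \<open>'c\<close>. Compatibility with
  the structure maps \<open>c \<mapsto> \<kappa> c\<close> and \<open>c \<mapsto> c I\<close> makes the ring homomorphism \<open>F\<^sub>q\<close>-linear.\<close>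

definition anderson_module ::
    "nat \<Rightarrow> 'c::alg_closed_field set \<Rightarrow> 'c \<Rightarrow> 'c \<Rightarrow> ('c \<Rightarrow> 'f::field) \<Rightarrow> 'f \<Rightarrow> 'f \<Rightarrow>
     nat \<Rightarrow> ('f \<Rightarrow> nat \<Rightarrow> 'c mat) \<Rightarrow> bool" where
  "anderson_module q Fq \<theta> \<eta> \<kappa> t y n \<rho> \<longleftrightarrow>
     \<rho> \<in> Ring.ring_hom (restrict_ring (A_ring Fq \<kappa> t y)) (twisted_poly_ring q n UNIV) \<and>
     (\<forall>c\<in>Fq. \<rho> (\<kappa> c) = scalar_tp n c) \<and>
     (\<forall>a\<in>A_ring Fq \<kappa> t y.
        \<exists>N. nilpotent_mat n N \<and> \<rho> a 0 = iota Fq \<theta> \<eta> \<kappa> t y a \<cdot>\<^sub>m 1\<^sub>m n + N)"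

section \<open>The map \<open>\<rho>\<^sup>\<otimes>\<^sup>n\<close>\<close>

text \<open>Matrix indices start at 0, while the constants \<open>a\<^sub>i, y\<^sub>i, z\<^sub>i\<close> are numbered from 1.\<close>

definition d_theta :: "nat \<Rightarrow> 'c::field \<Rightarrow> (nat \<Rightarrow> 'c) \<Rightarrow> 'c mat" where
  "d_theta n \<theta> a = mat n n (\<lambda>(r, s).
     if s = r then \<theta> else if s = r + 1 then a (r + 1) else if s = r + 2 then 1 else 0)"

definition E_theta :: "nat \<Rightarrow> (nat \<Rightarrow> 'c::field) \<Rightarrow> 'c mat" where
  "E_theta n a = mat n n (\<lambda>(r, s).
     if r + 2 = n then (if s = 0 then 1 else 0)
     else if r + 1 = n then (if s = 0 then a n else if s = 1 then 1 else 0)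
     else 0)"

definition rho_t :: "nat \<Rightarrow> 'c::field \<Rightarrow> (nat \<Rightarrow> 'c) \<Rightarrow> nat \<Rightarrow> 'c mat" where
  "rho_t n \<theta> a = (\<lambda>i. if i = 0 then d_theta n \<theta> a else if i = 1 then E_theta n a else 0\<^sub>m n n)"

definition d_eta :: "nat \<Rightarrow> 'c::field \<Rightarrow> (nat \<Rightarrow> 'c) \<Rightarrow> (nat \<Rightarrow> 'c) \<Rightarrow> 'c mat" where
  "d_eta n \<eta> yc zc = mat n n (\<lambda>(r, s).
     if s = r then \<eta> else if s = r + 1 then yc (r + 1) else if s = r + 2 then zc (r + 1)
     else if s = r + 3 then 1 else 0)"

definition E_eta :: "nat \<Rightarrow> (nat \<Rightarrow> 'c::field) \<Rightarrow> (nat \<Rightarrow> 'c) \<Rightarrow> 'c mat" where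
  "E_eta n yc zc = mat n n (\<lambda>(r, s).
     if r + 3 = n then (if s = 0 then 1 else 0)
     else if r + 2 = n then (if s = 0 then zc (n - 1) else if s = 1 then 1 else 0)
     else if r + 1 = n then (if s = 0 then yc n else if s = 1 then zc n
                             else if s = 2 then 1 else 0)
     else 0)"

text \<open>For \<open>n = 2\<close> the rows of \<open>E\<^sub>\<eta>\<close> displayed above do not fit into a 2 by 2 matrix: the entry 1
  in the third column of the last row, which is the coefficient of \<open>g\<^sub>5 = (f f^(1))^2 g\<^sub>1^(2)\<close>
  in \<open>y g\<^sub>2\<close>, belongs to \<open>\<tau>\<^sup>2\<close>. Hence \<open>\<rho>\<^sub>y\<close> gets a \<open>\<tau>\<^sup>2\<close>-term exactly when \<open>n = 2\<close>.\<close>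

definition rho_y ::
    "nat \<Rightarrow> 'c::field \<Rightarrow> (nat \<Rightarrow> 'c) \<Rightarrow> (nat \<Rightarrow> 'c) \<Rightarrow> nat \<Rightarrow> 'c mat" where
  "rho_y n \<eta> yc zc = (\<lambda>i.
     if i = 0 then d_eta n \<eta> yc zc
     else if i = 1 then E_eta n yc zc
     else if i = 2 \<and> n = 2 then mat n n (\<lambda>(r, s). if r = 1 \<and> s = 0 then 1 else 0)
     else 0\<^sub>m n n)"

definition poly_in_tp :: "nat \<Rightarrow> nat \<Rightarrow> 'c::field poly \<Rightarrow> (nat \<Rightarrow> 'c mat) \<Rightarrow> nat \<Rightarrow> 'c mat" where
  "poly_in_tp q n c P =
     (let R = twisted_poly_ring q n UNIV in
      (\<Oplus>\<^bsub>R\<^esub> i\<in>{..Polynomial.degree c}.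
         scalar_tp n (Polynomial.coeff c i) \<otimes>\<^bsub>R\<^esub> (P [^]\<^bsub>R\<^esub> i)))"

definition rho_tensor ::
    "nat \<Rightarrow> 'c::field set \<Rightarrow> 'c \<Rightarrow> 'c \<Rightarrow> ('c \<Rightarrow> 'f::field) \<Rightarrow> 'f \<Rightarrow> 'f \<Rightarrow> nat \<Rightarrow>
     (nat \<Rightarrow> 'c) \<Rightarrow> (nat \<Rightarrow> 'c) \<Rightarrow> (nat \<Rightarrow> 'c) \<Rightarrow> 'f \<Rightarrow> nat \<Rightarrow> 'c mat" where
  "rho_tensor q Fq \<theta> \<eta> \<kappa> t y n a yc zc b =
     (case A_coords Fq \<kappa> t y b of (c, d) \<Rightarrow>
        let R = twisted_poly_ring q n UNIV; Pt = rho_t n \<theta> a; Py = rho_y n \<eta> yc zc in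
        poly_in_tp q n c Pt \<oplus>\<^bsub>R\<^esub> (Py \<otimes>\<^bsub>R\<^esub> poly_in_tp q n d Pt))"

end

theory Submission
  imports Defs "Jordan_Normal_Form.Char_Poly"
begin

text \<open>A matrix \<open>P = \<Sum> P\<^sub>i \<tau>\<^sup>i\<close> acts on the functions \<open>g\<^sub>1, g\<^sub>2, \<dots>\<close>: its row \<open>r\<close> gives the linear combination
  \<open>\<Sum> (P\<^sub>i)\<^sub>r\<^sub>s g\<^bsub>in+s\<^esub>\<close>. The relations for \<open>t g\<^sub>i\<close> and \<open>y g\<^sub>i\<close> say that row \<open>r\<close> of \<open>\<rho>\<^sub>t\<close> and \<open>\<rho>\<^sub>y\<close> gives
  \<open>t g\<^sub>r\<close> and \<open>y g\<^sub>r\<close>, and since twisting fixes \<open>t\<close> and \<open>y\<close>, products of such matrices correspond to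
  products of functions; hence row \<open>r\<close> of \<open>\<rho>\<^sub>b\<close> gives \<open>b g\<^sub>r\<close>. The \<open>g\<^sub>i\<close> have pairwise distinct orders at
  infinity, so they are linearly independent, a matrix is determined by its action, and \<open>\<rho>\<close> is
  multiplicative. Commutativity of \<open>\<rho>\<^sub>t\<close> and \<open>\<rho>\<^sub>y\<close> and the curve equation need not be checked.\<close>

section \<open>Subfields of a type\<close>

lemma univ_field_sel [simp]:
  "carrier univ_field = UNIV" "x \<oplus>\<^bsub>univ_field\<^esub> y = x + y" "x \<otimes>\<^bsub>univ_field\<^esub> y = x * y"
  "\<one>\<^bsub>univ_field\<^esub> = 1" "\<zero>\<^bsub>univ_field\<^esub> = 0"
  by (simp_all add: ring_of_type_algebra_def)

lemma field_univ_field: "field (univ_field :: 'a::field ring)"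
  by (rule field_from_type_algebra)

lemma a_inv_univ_field [simp]: "\<ominus>\<^bsub>univ_field\<^esub> x = - (x :: 'a::field)"
proof -
  interpret field "univ_field :: 'a ring" by (rule field_univ_field)
  show ?thesis by (rule minus_equality) simp_all
qed

lemma m_inv_univ_field: "x \<noteq> 0 \<Longrightarrow> inv\<^bsub>univ_field\<^esub> x = inverse (x :: 'a::field)"
proof -
  assume "x \<noteq> 0"
  interpret field "univ_field :: 'a ring" by (rule field_univ_field)
  show ?thesis by (rule comm_inv_char) (use \<open>x \<noteq> 0\<close> in simp_all)
qed

lemma subring_univ_fieldD:
  fixes S :: "'a::field set"
  assumes "subring S univ_field"
  shows "0 \<in> S" "1 \<in> S" "\<And>x. x \<in> S \<Longrightarrow> - x \<in> S"
    "\<And>x y. x \<in> S \<Longrightarrow> y \<in> S \<Longrightarrow> x + y \<in> S"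
    "\<And>x y. x \<in> S \<Longrightarrow> y \<in> S \<Longrightarrow> x - y \<in> S"
    "\<And>x y. x \<in> S \<Longrightarrow> y \<in> S \<Longrightarrow> x * y \<in> S"
    "\<And>x k. x \<in> S \<Longrightarrow> x ^ k \<in> S"
proof -
  note e = subringE[OF assms, simplified]
  show 0: "0 \<in> S" and 1: "1 \<in> S" and m: "\<And>x. x \<in> S \<Longrightarrow> - x \<in> S"
    and a: "\<And>x y. x \<in> S \<Longrightarrow> y \<in> S \<Longrightarrow> x + y \<in> S"
    and p: "\<And>x y. x \<in> S \<Longrightarrow> y \<in> S \<Longrightarrow> x * y \<in> S"
    using e by auto
  show "\<And>x y. x \<in> S \<Longrightarrow> y \<in> S \<Longrightarrow> x - y \<in> S"
    using m a by (metis diff_conv_add_uminus)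
  show "\<And>x k. x \<in> S \<Longrightarrow> x ^ k \<in> S"
  proof -
    fix x k assume "x \<in> S" then show "x ^ k \<in> S" by (induction k) (auto intro: 1 p)
  qed
qed

lemma subring_univ_field_sum:
  fixes S :: "'a::field set"
  assumes "subring S univ_field" "\<And>i. i \<in> A \<Longrightarrow> f i \<in> S"
  shows "sum f A \<in> S"
  using assms(2)
  by (induction A rule: infinite_finite_induct) (auto intro: subring_univ_fieldD[OF assms(1)])

lemma subfield_univ_field_subring: "subfield S univ_field \<Longrightarrow> subring S univ_field"
  by (simp add: subfield_def subdomain_def subcring_def)

text \<open>Multiplication by a nonzero \<open>c\<close> permutes the nonzero elements of
  \<open>S\<close>; comparing their products gives \<open>c ^ (card S - 1) = 1\<close>. This is why
  constants from \<open>Fq\<close> are fixed by the twist.\<close>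

lemma finite_subfield_frobenius:
  fixes S :: "'a::field set"
  assumes "subfield S univ_field" "finite S" "c \<in> S"
  shows "c ^ card S = c"
proof (cases "c = 0")
  case True
  then show ?thesis using assms by (simp add: card_gt_0_iff) (use assms in auto)
next
  case False
  note S = subring_univ_fieldD[OF subfield_univ_field_subring[OF assms(1)]]
  let ?T = "S - {0}"
  have inj: "inj_on ((*) c) ?T" using False by (simp add: inj_on_def)
  have "(*) c ` ?T = ?T"
  proof (rule card_subset_eq)
    show "(*) c ` ?T \<subseteq> ?T" using False assms(3) S(6) by auto
    show "card ((*) c ` ?T) = card ?T" using inj by (rule card_image)
  qed (use assms in simp)
  then have "\<Prod>?T = (\<Prod>x\<in>?T. c * x)" using inj by (metis prod.reindex_cong)
  also have "\<dots> = c ^ card ?T * \<Prod>?T" by (simp add: prod.distrib)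
  finally have "c ^ card ?T = 1" using assms(2) by simp
  moreover have "card S = Suc (card ?T)" using assms(2) S(1) by (metis card.remove)
  ultimately show ?thesis by simp
qed

text \<open>Passes from the carrier-based homomorphisms of the definitions to the locale
  \<open>field_hom\<close> with its rewrite rules.\<close>

lemma field_hom_univ_field:
  assumes "h \<in> Ring.ring_hom univ_field univ_field"
  shows "field_hom (h :: 'a::field \<Rightarrow> 'b::field)"
proof -
  interpret A: field "univ_field :: 'a ring" by (rule field_univ_field)
  interpret B: field "univ_field :: 'b ring" by (rule field_univ_field)
  interpret ring_hom_ring "univ_field :: 'a ring" "univ_field :: 'b ring" h
    by (rule ring_hom_ringI2) (use assms A.ring_axioms B.ring_axioms in auto)
  show ?thesis
  proof unfold_locales
    show "h (x * y) = h x * h y" for x y using hom_mult[of x y] by simp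
    show "h (x + y) = h x + h y" for x y using hom_add[of x y] by simp
    show "h 1 = 1" using hom_one by simp
    show "h 0 = 0" using hom_zero by simp
  qed
qed

section \<open>Functions on the curve\<close>

locale curve_functions = \<kappa>: field_hom \<kappa> for \<kappa> :: "'c::field \<Rightarrow> 'f::field" +
  fixes E :: "'c weierstrass" and t y :: 'f
  assumes t_y_eq: "weierstrass_eq (map_weierstrass \<kappa> E) t y"
begin

sublocale mp: map_poly_comm_ring_hom \<kappa> ..

abbreviation rf :: "'c poly \<Rightarrow> 'c poly \<Rightarrow> 'f" where
  "rf \<equiv> regular_fun \<kappa> t y"

text \<open>Over all constants this is the affine coordinate ring; over \<open>Fq\<close> it
  contains the ring A, see \<open>A_ring_subset_regular_over\<close>.\<close>

definition regular_over :: "'c set \<Rightarrow> 'f set" where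
  "regular_over S = {rf c d |c d. set (coeffs c) \<subseteq> S \<and> set (coeffs d) \<subseteq> S}"

lemma curve_eq:
  "y * y = t ^ 3 + \<kappa> (c2 E) * t ^ 2 + \<kappa> (c4 E) * t + \<kappa> (c6 E) - \<kappa> (c1 E) * t * y - \<kappa> (c3 E) * y"
  using t_y_eq by (simp add: weierstrass_eq_def weierstrass.map_sel power2_eq_square algebra_simps)

lemma rf_add: "rf c d + rf c' d' = rf (c + c') (d + d')"
  by (simp add: regular_fun_def mp.hom_add algebra_simps)

lemma rf_uminus: "- rf c d = rf (- c) (- d)"
  by (simp add: regular_fun_def mp.hom_uminus)

text \<open>The Weierstrass equation replaces \<open>y * y\<close> by
  \<open>P(t) - y * Q(t)\<close>, with the cubic \<open>P\<close> and
  \<open>Q(t) = c1 t + c3\<close>.\<close>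

lemma rf_mult:
  "rf c d * rf c' d' =
   rf (c * c' + d * d' * [:c6 E, c4 E, c2 E, 1:]) (c * d' + d * c' - d * d' * [:c3 E, c1 E:])"
proof -
  let ?p = "\<lambda>c. poly (map_poly \<kappa> c) t"
  define P Q where "P = [:c6 E, c4 E, c2 E, 1:]" and "Q = [:c3 E, c1 E:]"
  have 1: "?p P = t ^ 3 + \<kappa> (c2 E) * t ^ 2 + \<kappa> (c4 E) * t + \<kappa> (c6 E)"
    by (simp add: P_def \<kappa>.map_poly_pCons_hom algebra_simps power2_eq_square power3_eq_cube)
  have 2: "?p Q = \<kappa> (c1 E) * t + \<kappa> (c3 E)"
    by (simp add: Q_def \<kappa>.map_poly_pCons_hom algebra_simps)
  have "rf c d * rf c' d' = ?p c * ?p c' + y * (?p c * ?p d' + ?p d * ?p c') + (y * y) * (?p d * ?p d')"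
    by (simp add: regular_fun_def algebra_simps)
  then show ?thesis unfolding curve_eq P_def[symmetric] Q_def[symmetric]
    by (simp add: regular_fun_def mp.hom_add mp.hom_mult mp.hom_minus 1 2 algebra_simps)
qed

lemma rf_const: "\<kappa> a = rf [:a:] 0"
  by (simp add: regular_fun_def \<kappa>.map_poly_pCons_hom)

lemma rf_t: "t = rf [:0, 1:] 0"
  by (simp add: regular_fun_def \<kappa>.map_poly_pCons_hom)

lemma rf_y: "y = rf 0 1"
  by (simp add: regular_fun_def)

lemma regular_over_closed:
  assumes S: "subring S univ_field" and E: "set_weierstrass E \<subseteq> S"
  shows "a \<in> S \<Longrightarrow> \<kappa> a \<in> regular_over S" "t \<in> regular_over S" "y \<in> regular_over S"
    "x \<in> regular_over S \<Longrightarrow> - x \<in> regular_over S"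
    "x \<in> regular_over S \<Longrightarrow> x' \<in> regular_over S \<Longrightarrow> x + x' \<in> regular_over S"
    "x \<in> regular_over S \<Longrightarrow> x' \<in> regular_over S \<Longrightarrow> x * x' \<in> regular_over S"
proof -
  note sum = subring_univ_field_sum[OF S]
  note S = subring_univ_fieldD[OF S]
  \<comment> \<open>As 0 lies in \<open>S\<close>, the condition may be imposed on all coefficients,
    also beyond the degree, and becomes pointwise.\<close>
  have coeffs: "set (coeffs p) \<subseteq> S \<longleftrightarrow> (\<forall>i. coeff p i \<in> S)" for p
  proof -
    have "set (coeffs p) \<subseteq> S \<longleftrightarrow> range (coeff p) \<subseteq> S" using S(1) by (simp add: range_coeff)
    then show ?thesis by auto
  qed
  have mult: "set (coeffs (p * p')) \<subseteq> S" if "set (coeffs p) \<subseteq> S" "set (coeffs p') \<subseteq> S" for p p'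
    using that unfolding coeffs by (auto simp: coeff_mult intro!: sum S(6))
  have add: "set (coeffs (p + p')) \<subseteq> S" if "set (coeffs p) \<subseteq> S" "set (coeffs p') \<subseteq> S" for p p'
    using that unfolding coeffs by (auto intro!: S(4))
  have uminus: "set (coeffs (- p)) \<subseteq> S" if "set (coeffs p) \<subseteq> S" for p
    using that unfolding coeffs by (auto intro!: S(3))
  have pCons: "set (coeffs (pCons a p)) \<subseteq> S" if "a \<in> S" "set (coeffs p) \<subseteq> S" for a p
    using that unfolding coeffs by (auto simp: coeff_pCons split: nat.split)
  have zero: "set (coeffs 0) \<subseteq> S" by simp
  have one: "set (coeffs 1) \<subseteq> S" using S(2) by simp
  have Ec: "c1 E \<in> S" "c2 E \<in> S" "c3 E \<in> S" "c4 E \<in> S" "c6 E \<in> S"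
    using E by (cases E; simp)+
  have I: "x \<in> regular_over S"
    if "x = rf c d" "set (coeffs c) \<subseteq> S" "set (coeffs d) \<subseteq> S" for x c d
    using that by (auto simp: regular_over_def)
  show "a \<in> S \<Longrightarrow> \<kappa> a \<in> regular_over S"
    by (rule I[OF rf_const pCons[OF _ zero] zero])
  show "t \<in> regular_over S"
    by (rule I[OF rf_t pCons[OF S(1) pCons[OF S(2) zero]] zero])
  show "y \<in> regular_over S"
    by (rule I[OF rf_y zero one])
  show "x \<in> regular_over S \<Longrightarrow> - x \<in> regular_over S"
    unfolding regular_over_def using rf_uminus uminus by blast
  show "x \<in> regular_over S \<Longrightarrow> x' \<in> regular_over S \<Longrightarrow> x + x' \<in> regular_over S"
    unfolding regular_over_def using rf_add add by blast
  show "x \<in> regular_over S \<Longrightarrow> x' \<in> regular_over S \<Longrightarrow> x * x' \<in> regular_over S"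
  proof -
    assume "x \<in> regular_over S" "x' \<in> regular_over S"
    then obtain c d c' d' where x: "x = rf c d" "x' = rf c' d'"
      and c: "set (coeffs c) \<subseteq> S" "set (coeffs d) \<subseteq> S" "set (coeffs c') \<subseteq> S" "set (coeffs d') \<subseteq> S"
      by (auto simp: regular_over_def)
    show "x * x' \<in> regular_over S"
      unfolding x by (rule I[OF rf_mult])
        (unfold diff_conv_add_uminus, (intro add mult uminus c pCons Ec S(2) zero)+)
  qed
qed

lemma A_ring_subset_regular_over:
  assumes S: "subring S univ_field" and E: "set_weierstrass E \<subseteq> S"
  shows "A_ring S \<kappa> t y \<subseteq> regular_over S"
proof
  fix x assume "x \<in> A_ring S \<kappa> t y"
  then show "x \<in> regular_over S"
    unfolding A_ring_def
  proof (induction rule: generate_ring.induct)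
    case one
    have "\<kappa> 1 \<in> regular_over S"
      using subring_univ_fieldD(2)[OF S] by (rule regular_over_closed(1)[OF S E])
    then show ?case by simp
  qed (auto intro: regular_over_closed[OF S E])
qed

text \<open>Regular functions form a ring, so their quotients are closed under the field operations.
  Orders of arbitrary functions can thus be read off from polynomial degrees.\<close>

lemma generate_field_regular_quotient:
  assumes "x \<in> generate_field univ_field (range \<kappa> \<union> {t, y})"
  shows "\<exists>u v. u \<in> regular_over UNIV \<and> v \<in> regular_over UNIV \<and> v \<noteq> 0 \<and> x = u / v"
proof -
  have S: "subring UNIV (univ_field :: 'c ring)"
    using ring.carrier_is_subring[OF field.is_ring[OF field_univ_field]] by simp
  note cl = regular_over_closed[OF S subset_UNIV]
  have one: "1 \<in> regular_over UNIV" using cl(1)[of 1] by simp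
  have reg: "\<exists>u v. u \<in> regular_over UNIV \<and> v \<in> regular_over UNIV \<and> v \<noteq> 0 \<and> x = u / v"
    if "x \<in> regular_over UNIV" for x
    using that one by (intro exI[of _ x] exI[of _ 1]) simp
  show ?thesis using assms
  proof (induction rule: generate_field.induct)
    case one
    then show ?case using reg[OF \<open>1 \<in> regular_over UNIV\<close>] by simp
  next
    case (incl h)
    then show ?case using reg cl(1-3) by auto
  next
    case (a_inv h)
    then obtain u v where "u \<in> regular_over UNIV" "v \<in> regular_over UNIV" "v \<noteq> 0" "h = u / v" by blast
    then show ?case using cl(4)[of u] by (intro exI[of _ "-u"] exI[of _ v]) simp
  next
    case (m_inv h)
    then obtain u v where "u \<in> regular_over UNIV" "v \<in> regular_over UNIV" "v \<noteq> 0" "h = u / v" by blast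
    then show ?case using m_inv by (intro exI[of _ v] exI[of _ u]) (auto simp: m_inv_univ_field)
  next
    case (eng_add h1 h2)
    then obtain u v u' v' where "u \<in> regular_over UNIV" "v \<in> regular_over UNIV" "v \<noteq> 0" "h1 = u / v"
      "u' \<in> regular_over UNIV" "v' \<in> regular_over UNIV" "v' \<noteq> 0" "h2 = u' / v'" by blast
    then show ?case
      by (intro exI[of _ "u * v' + u' * v"] exI[of _ "v * v'"]) (auto intro!: cl simp: add_frac_eq)
  next
    case (eng_mult h1 h2)
    then obtain u v u' v' where "u \<in> regular_over UNIV" "v \<in> regular_over UNIV" "v \<noteq> 0" "h1 = u / v"
      "u' \<in> regular_over UNIV" "v' \<in> regular_over UNIV" "v' \<noteq> 0" "h2 = u' / v'" by blast
    then show ?case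
      by (intro exI[of _ "u * u'"] exI[of _ "v * v'"]) (auto intro!: cl)
  qed
qed

end

section \<open>The order at infinity\<close>

text \<open>\<open>w 0\<close> is unspecified, so \<open>w t < 0\<close> does not exclude
  \<open>t = 0\<close>; this is therefore a separate assumption, while \<open>y \<noteq> 0\<close>
  follows from the curve equation.\<close>

locale order_at_infinity = curve_functions +
  fixes w :: "'b \<Rightarrow> int"
  assumes t_nonzero: "t \<noteq> 0" and w_order: "is_order_at \<kappa> t y Infinity w"
begin

lemma w_mult: "u \<noteq> 0 \<Longrightarrow> v \<noteq> 0 \<Longrightarrow> w (u * v) = w u + w v"
  and w_add_ge: "u \<noteq> 0 \<Longrightarrow> v \<noteq> 0 \<Longrightarrow> u + v \<noteq> 0 \<Longrightarrow> min (w u) (w v) \<le> w (u + v)"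
  and ex_w_eq_1: "\<exists>u. u \<noteq> 0 \<and> w u = 1"
  and w_const: "c \<noteq> 0 \<Longrightarrow> w (\<kappa> c) = 0"
  and w_t_neg: "w t < 0" and w_y_neg: "w y < 0"
  using w_order by (auto simp: is_order_at_def normalized_valuation_def)

lemma w_one [simp]: "w 1 = 0"
  using w_const[of 1] by simp

lemma w_uminus [simp]: "w (- u) = w u"
proof (cases "u = 0")
  case False
  have "w (- u) = w (\<kappa> (- 1) * u)" by (simp add: hom_distribs)
  also have "\<dots> = w u" using False w_const[of "-1"] by (subst w_mult) (auto simp: hom_distribs)
  finally show ?thesis .
qed simp

lemma w_power: "u \<noteq> 0 \<Longrightarrow> w (u ^ k) = int k * w u"
  by (induction k) (auto simp: w_mult algebra_simps)

lemma w_divide: "u \<noteq> 0 \<Longrightarrow> v \<noteq> 0 \<Longrightarrow> w (u / v) = w u - w v"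
  using w_mult[of "u / v" v] by simp

lemma w_add_less:
  assumes "u \<noteq> 0" "v \<noteq> 0" "w u < w v"
  shows "u + v \<noteq> 0" "w (u + v) = w u"
proof -
  show *: "u + v \<noteq> 0"
    using assms by (metis add_eq_0_iff less_irrefl w_uminus)
  \<comment> \<open>Write \<open>u\<close> as \<open>(u + v) + (- v)\<close>: an order of
    \<open>u + v\<close> above that of \<open>u\<close> would contradict the ultrametric
    inequality.\<close>
  have "min (w (u + v)) (w (- v)) \<le> w ((u + v) + - v)"
    by (rule w_add_ge) (use assms * in auto)
  moreover have "min (w u) (w v) \<le> w (u + v)" using assms * w_add_ge by blast
  ultimately show "w (u + v) = w u" using assms by simp
qed

lemma w_add_neq:
  assumes "u \<noteq> 0" "v \<noteq> 0" "w u \<noteq> w v"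
  shows "u + v \<noteq> 0 \<and> w (u + v) = min (w u) (w v)"
  using w_add_less[of u v] w_add_less[of v u] assms by (cases "w u < w v") (auto simp: add.commute)

text \<open>Treats 0 as having infinite order, so that the bound is stable under sums without side
  conditions.\<close>

definition order_ge :: "int \<Rightarrow> 'b \<Rightarrow> bool" where
  "order_ge k u \<longleftrightarrow> u = 0 \<or> k \<le> w u"

lemma order_ge_add: "order_ge k u \<Longrightarrow> order_ge k v \<Longrightarrow> order_ge k (u + v)"
  using w_add_ge[of u v] by (fastforce simp: order_ge_def)

lemma order_ge_uminus: "order_ge k u \<Longrightarrow> order_ge k (- u)"
  by (auto simp: order_ge_def)

lemma order_ge_diff: "order_ge k u \<Longrightarrow> order_ge k v \<Longrightarrow> order_ge k (u - v)"
  using order_ge_add[of k u "- v"] order_ge_uminus[of k v] by simp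

lemma order_ge_const_mult: "order_ge k u \<Longrightarrow> order_ge k (\<kappa> c * u)"
  by (cases "c = 0"; cases "u = 0") (auto simp: order_ge_def w_mult w_const)

text \<open>Used with \<open>u\<close> the dominant term of \<open>v\<close>: the remainder has
  strictly higher order and cannot alter that of \<open>u\<close>.\<close>

lemma w_eq_of_order_ge:
  assumes "u \<noteq> 0" "order_ge k (v - u)" "w u < k"
  shows "v \<noteq> 0" "w v = w u"
proof -
  have "v \<noteq> 0 \<and> w v = w u"
  proof (cases "v - u = 0")
    case False
    then show ?thesis using w_add_less[of u "v - u"] assms by (auto simp: order_ge_def)
  qed (use assms in auto)
  then show "v \<noteq> 0" "w v = w u" by auto
qed

text \<open>With \<open>y = 0\<close> the lower powers of \<open>t\<close> would have to cancel
  \<open>t ^ 3\<close>, whose order is strictly below theirs.\<close>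

lemma y_nonzero: "y \<noteq> 0"
proof
  assume "y = 0"
  \<comment> \<open>The factor 1 gives the constant term the form \<open>\<kappa> c * u\<close>, so
    that \<open>order_ge_const_mult\<close> covers it even when it vanishes.\<close>
  then have "t ^ 3 + (\<kappa> (c2 E) * t ^ 2 + \<kappa> (c4 E) * t + \<kappa> (c6 E) * 1) = 0"
    using curve_eq by (simp add: add.assoc)
  then have "0 - t ^ 3 = \<kappa> (c2 E) * t ^ 2 + \<kappa> (c4 E) * t + \<kappa> (c6 E) * 1"
    using minus_unique by fastforce
  moreover have "order_ge (3 * w t + 1) \<dots>"
    using t_nonzero w_t_neg
    by (intro order_ge_add order_ge_const_mult) (auto simp: order_ge_def w_power)
  ultimately show False
    using w_eq_of_order_ge(1)[of "t ^ 3" "3 * w t + 1" 0] t_nonzero by (simp add: w_power)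
qed

text \<open>If the orders of \<open>y * y\<close> and \<open>t ^ 3\<close> differed, the lower one
  would be below the orders of all other monomials of the equation, and its term could not be
  cancelled.\<close>

lemma w_t_y: "2 * w y = 3 * w t"
proof (rule ccontr)
  assume ne: "2 * w y \<noteq> 3 * w t"
  note w = w_power w_mult t_nonzero y_nonzero
  have eq: "y * y + \<kappa> (c1 E) * (t * y) + \<kappa> (c3 E) * y - \<kappa> (c2 E) * t ^ 2 - \<kappa> (c4 E) * t - \<kappa> (c6 E) * 1 = t ^ 3"
    using curve_eq by (simp add: algebra_simps)
  consider "2 * w y < 3 * w t" | "3 * w t < 2 * w y" using ne by linarith
  then show False
  proof cases
    case 1
    have "t ^ 3 - y * y = \<kappa> (c1 E) * (t * y) + \<kappa> (c3 E) * y - \<kappa> (c2 E) * t ^ 2 - \<kappa> (c4 E) * t - \<kappa> (c6 E) * 1"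
      using eq by (simp add: algebra_simps)
    moreover have "order_ge (2 * w y + 1) \<dots>"
      using 1 w_t_neg w_y_neg
      by (intro order_ge_add order_ge_diff order_ge_const_mult) (auto simp: order_ge_def w)
    ultimately show False
      using w_eq_of_order_ge(2)[of "y * y" "2 * w y + 1" "t ^ 3"] 1 by (simp add: w)
  next
    case 2
    have "y * y - t ^ 3 = - (\<kappa> (c1 E) * (t * y)) - \<kappa> (c3 E) * y + \<kappa> (c2 E) * t ^ 2 + \<kappa> (c4 E) * t + \<kappa> (c6 E) * 1"
      using eq by (simp add: algebra_simps)
    moreover have "order_ge (3 * w t + 1) \<dots>"
      using 2 w_t_neg w_y_neg
      by (intro order_ge_add order_ge_diff order_ge_uminus order_ge_const_mult) (auto simp: order_ge_def w)
    ultimately show False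
      using w_eq_of_order_ge(2)[of "t ^ 3" "3 * w t + 1" "y * y"] 2 by (simp add: w)
  qed
qed

section \<open>Orders of regular functions and uniqueness of coordinates\<close>

lemma w_poly:
  assumes "c \<noteq> 0"
  shows "poly (map_poly \<kappa> c) t \<noteq> 0 \<and> w (poly (map_poly \<kappa> c) t) = int (Polynomial.degree c) * w t"
  using assms
proof (induction c)
  case (pCons a c)
  show ?case
  proof (cases "c = 0")
    case True
    then show ?thesis using pCons by (simp add: \<kappa>.map_poly_pCons_hom w_const)
  next
    case False
    let ?u = "t * poly (map_poly \<kappa> c) t"
    have u: "?u \<noteq> 0" "w ?u = int (Suc (Polynomial.degree c)) * w t"
      using pCons.IH[OF False] t_nonzero by (auto simp: w_mult algebra_simps)
    have "w ?u < 0" using u w_t_neg by (simp add: mult_pos_neg del: of_nat_Suc)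
    have "order_ge 0 (\<kappa> a * 1)" by (rule order_ge_const_mult) (simp add: order_ge_def)
    then show ?thesis
      using w_eq_of_order_ge[of ?u 0 "\<kappa> a + ?u"] u \<open>w ?u < 0\<close> False
      by (simp add: \<kappa>.map_poly_pCons_hom)
  qed
qed simp

text \<open>The pole order of a nonzero \<open>c(t) + y d(t)\<close> once \<open>w t = - 2\<close>
  is known. The case \<open>d = 0\<close> is separate because the zero polynomial has degree 0 and
  would contribute 3.\<close>

definition pole_degree :: "'a poly \<Rightarrow> 'a poly \<Rightarrow> nat" where
  "pole_degree c d =
     (if d = 0 then 2 * Polynomial.degree c
      else max (2 * Polynomial.degree c) (2 * Polynomial.degree d + 3))"

text \<open>\<open>2 * degree c\<close> is even and \<open>2 * degree d + 3\<close> odd, so the two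
  summands have different orders and never cancel. The equation is doubled because so far only
  \<open>2 * w y = 3 * w t\<close> is known.\<close>

lemma w_rf:
  assumes "c \<noteq> 0 \<or> d \<noteq> 0"
  shows "rf c d \<noteq> 0 \<and> 2 * w (rf c d) = int (pole_degree c d) * w t"
proof (cases "d = 0")
  case True
  then show ?thesis using assms w_poly[of c] by (simp add: regular_fun_def pole_degree_def)
next
  case d: False
  let ?v = "y * poly (map_poly \<kappa> d) t"
  have v: "?v \<noteq> 0" "2 * w ?v = int (2 * Polynomial.degree d + 3) * w t"
    using w_poly[OF d] y_nonzero w_t_y by (auto simp: w_mult algebra_simps)
  show ?thesis
  proof (cases "c = 0")
    case True
    then show ?thesis using v d by (simp add: regular_fun_def pole_degree_def max_def)
  next
    case c: False
    let ?u = "poly (map_poly \<kappa> c) t"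
    have u: "?u \<noteq> 0" "2 * w ?u = int (2 * Polynomial.degree c) * w t"
      using w_poly[OF c] by auto
    have ne: "2 * Polynomial.degree c \<noteq> 2 * Polynomial.degree d + 3" by presburger
    then have "2 * w ?u \<noteq> 2 * w ?v" unfolding u v using w_t_neg by simp
    then have *: "?u + ?v \<noteq> 0 \<and> 2 * w (?u + ?v) = min (2 * w ?u) (2 * w ?v)"
      using w_add_neq[OF u(1) v(1)] by (auto simp: min_def)
    have "min (2 * w ?u) (2 * w ?v) = int (pole_degree c d) * w t"
      unfolding u v pole_degree_def using d w_t_neg mult_less_cancel_right_disj[of "int (2 * Polynomial.degree c)" "w t" "int (2 * Polynomial.degree d + 3)"]
      by (auto simp: min_def max_def simp del: of_nat_mult of_nat_add)
    then show ?thesis using * by (simp add: regular_fun_def)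
  qed
qed

lemma rf_eq_0_iff: "rf c d = 0 \<longleftrightarrow> c = 0 \<and> d = 0"
  using w_rf[of c d] by (auto simp: regular_fun_def)

lemma rf_eq_iff: "rf c d = rf c' d' \<longleftrightarrow> c = c' \<and> d = d'"
proof -
  have "rf c d = rf c' d' \<longleftrightarrow> rf c d + - rf c' d' = 0" by simp
  also have "\<dots> \<longleftrightarrow> c + - c' = 0 \<and> d + - d' = 0" unfolding rf_uminus rf_add rf_eq_0_iff ..
  finally show ?thesis by simp
qed

text \<open>A nonzero pair of polynomials gives a nonzero function, so coordinates are unique and
  the definite description in \<open>A_coords\<close> is meaningful.\<close>

lemma A_coords_rf:
  assumes "set (coeffs c) \<subseteq> S" "set (coeffs d) \<subseteq> S"
  shows "A_coords S \<kappa> t y (rf c d) = (c, d)"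
  unfolding A_coords_def by (rule the_equality) (use assms in \<open>auto simp: rf_eq_iff\<close>)

end

text \<open>Every function is a quotient of regular functions, so \<open>w t = -2\<close> is forced by \<open>w\<close> being
  normalized: otherwise all values of \<open>w\<close> would be divisible by \<open>- w t / 2\<close>.\<close>

locale order_at_infinity_generated = order_at_infinity +
  assumes generated: "generate_field univ_field (range \<kappa> \<union> {t, y}) = UNIV"
begin

lemma ex_quotient:
  obtains c d c' d' where "u = rf c d / rf c' d'" "rf c' d' \<noteq> 0"
  using generate_field_regular_quotient[of u] generated by (auto simp: regular_over_def)

lemma w_quotient:
  assumes "rf c d \<noteq> 0" "rf c' d' \<noteq> 0"
  shows "2 * w (rf c d / rf c' d') = (int (pole_degree c d) - int (pole_degree c' d')) * w t"
proof -
  have "2 * w (rf c d) = int (pole_degree c d) * w t" "2 * w (rf c' d') = int (pole_degree c' d') * w t"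
    using assms w_rf rf_eq_0_iff by blast+
  then show ?thesis using assms by (simp add: w_divide algebra_simps)
qed

lemma w_t: "w t = - 2" and w_y: "w y = - 3"
proof -
  obtain u where u: "u \<noteq> 0" "w u = 1" using ex_w_eq_1 by blast
  obtain c d c' d' where *: "u = rf c d / rf c' d'" "rf c' d' \<noteq> 0" by (rule ex_quotient)
  then have "2 * w u = (int (pole_degree c d) - int (pole_degree c' d')) * w t"
    using u w_quotient[of c d c' d'] by auto
  \<comment> \<open>The element of order 1 forces \<open>w t\<close> to divide 2; then -1 is
    excluded by \<open>2 * w y = 3 * w t\<close>.\<close>
  then have "w t dvd 2" using u by (metis dvd_triv_right mult.right_neutral)
  then have "\<bar>w t\<bar> \<le> 2" using zdvd_imp_le[of "\<bar>w t\<bar>" 2] by simp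
  then have "w t = -1 \<or> w t = -2" using w_t_neg by linarith
  moreover have "w t \<noteq> -1" using w_t_y by presburger
  ultimately show "w t = -2" by simp
  then show "w y = -3" using w_t_y by simp
qed

lemma w_quotient':
  assumes "rf c d \<noteq> 0" "rf c' d' \<noteq> 0"
  shows "w (rf c d / rf c' d') = int (pole_degree c' d') - int (pole_degree c d)"
  using w_quotient[OF assms] by (simp add: w_t)

text \<open>Orders of quotients of regular functions depend only on degrees. Since
  \<open>has_divisor\<close> chooses a valuation for each function separately, this is what allows a
  single \<open>w\<close> for all of them.\<close>

lemma w_unique:
  assumes "is_order_at \<kappa> t y Infinity w'" "u \<noteq> 0"
  shows "w' u = w u"
proof -
  interpret w': order_at_infinity_generated \<kappa> E t y w'
    by unfold_locales (use assms t_nonzero generated in auto)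
  obtain c d c' d' where *: "u = rf c d / rf c' d'" "rf c' d' \<noteq> 0" by (rule ex_quotient)
  then show ?thesis
    using assms(2) w_quotient'[of c d c' d'] w'.w_quotient'[of c d c' d']
    by (auto simp: pole_degree_def w'.pole_degree_def)
qed

text \<open>Composing \<open>w\<close> with \<open>tw\<close> gives again an order at infinity,
  since \<open>t\<close> and \<open>y\<close> are fixed and nonzero constants go to nonzero
  constants; uniqueness does the rest.\<close>

lemma w_twist:
  assumes "field_hom tw" "\<And>c. tw (\<kappa> c) = \<kappa> (c ^ q)" "tw t = t" "tw y = y" "u \<noteq> 0"
  shows "w (tw u) = w u"
proof -
  interpret tw: field_hom tw by (rule assms)
  have nz: "tw u \<noteq> 0 \<longleftrightarrow> u \<noteq> 0" for u by simp
  have "is_order_at \<kappa> t y Infinity (\<lambda>u. w (tw u))"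
    unfolding is_order_at_def normalized_valuation_def
  proof (intro conjI allI ballI impI)
    show "w (tw (u * v)) = w (tw u) + w (tw v)" if "u \<in> UNIV - {0}" "v \<in> UNIV - {0}" for u v
      using that by (simp add: w_mult tw.hom_mult)
    show "min (w (tw u)) (w (tw v)) \<le> w (tw (u + v))"
      if "u \<in> UNIV - {0}" "v \<in> UNIV - {0}" "u + v \<noteq> 0" for u v
      using that w_add_ge[of "tw u" "tw v"] nz[of "u + v"] by (simp add: tw.hom_add)
    \<comment> \<open>\<open>t / y\<close> is a uniformizer fixed by \<open>tw\<close>, so the
      composite is still normalized.\<close>
    have "tw (t / y) = t / y" by (simp add: divide_inverse tw.hom_mult tw.hom_inverse assms)
    moreover have "w (t / y) = 1" by (simp add: w_divide t_nonzero y_nonzero w_t w_y)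
    ultimately show "\<exists>u\<in>UNIV - {0}. w (tw u) = 1"
      using t_nonzero y_nonzero by (intro bexI[of _ "t / y"]) auto
    show "w (tw (\<kappa> c)) = 0" if "c \<noteq> 0" for c
      using that by (simp add: assms w_const)
  qed (use w_t_neg w_y_neg assms in auto)
  then show ?thesis using w_unique assms(5) by blast
qed

end

section \<open>Linear independence from distinct orders at infinity\<close>

lemma (in order_at_infinity) sum_nonzero:
  assumes "finite J" "J \<noteq> {}" "\<And>j. j \<in> J \<Longrightarrow> h j \<noteq> 0" "inj_on (\<lambda>j. w (h j)) J"
  shows "sum h J \<noteq> 0 \<and> (\<exists>j\<in>J. w (sum h J) = w (h j))"
  using assms
proof (induction J rule: finite_ne_induct)
  case (insert i J)
  then obtain j where j: "sum h J \<noteq> 0" "j \<in> J" "w (sum h J) = w (h j)" by auto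
  then have "w (h i) \<noteq> w (sum h J)" using insert.prems insert.hyps by (auto simp: inj_on_def)
  then have "h i + sum h J \<noteq> 0 \<and> w (h i + sum h J) = min (w (h i)) (w (h j))"
    using w_add_neq[of "h i" "sum h J"] j insert.prems by auto
  then show ?case using insert.hyps j by (auto simp: min_def)
qed auto

lemma (in order_at_infinity) independent_of_distinct_orders:
  assumes "finite J" "\<And>j. j \<in> J \<Longrightarrow> h j \<noteq> 0" "inj_on (\<lambda>j. w (h j)) J"
    and "(\<Sum>j\<in>J. \<kappa> (c j) * h j) = 0" "j \<in> J"
  shows "c j = 0"
proof (rule ccontr)
  assume "c j \<noteq> 0"
  \<comment> \<open>Terms with zero coefficient are discarded first, as \<open>w\<close> says
    nothing about 0; on the others the constants leave the orders unchanged.\<close>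
  let ?J = "{j \<in> J. c j \<noteq> 0}"
  have "(\<Sum>j\<in>?J. \<kappa> (c j) * h j) = (\<Sum>j\<in>J. \<kappa> (c j) * h j)"
    by (rule sum.mono_neutral_left) (use assms in auto)
  moreover have "(\<Sum>j\<in>?J. \<kappa> (c j) * h j) \<noteq> 0"
  proof -
    have "inj_on (\<lambda>j. w (\<kappa> (c j) * h j)) ?J"
      using assms(3) by (auto simp: inj_on_def w_mult w_const assms(2))
    then show ?thesis
      using sum_nonzero[of ?J "\<lambda>j. \<kappa> (c j) * h j"] assms(1,2,5) \<open>c j \<noteq> 0\<close> by auto
  qed
  ultimately show False using assms(4) by simp
qed

text \<open>The excess \<open>e i\<close> is 1 exactly if the last point in the divisor of \<open>g i\<close> is infinity. The
  relations propagate \<open>e i = 0\<close> from \<open>i\<close> to \<open>i + 2\<close> and \<open>i + 3\<close>, hence by periodicity \<open>e\<close> is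
  constant, and no information about the group law is needed.\<close>

lemma (in order_at_infinity_generated) inj_on_order:
  fixes n :: nat and g :: "nat \<Rightarrow> 'b" and e :: "nat \<Rightarrow> int"
  assumes n: "0 < n"
    and g_nz: "\<And>i. 1 \<le> i \<Longrightarrow> g i \<noteq> 0"
    and w_g: "\<And>i. 1 \<le> i \<Longrightarrow> w (g i) = int n - int i + e i"
    and e_cases: "\<And>i. 1 \<le> i \<Longrightarrow> e i = 0 \<or> e i = 1"
    and e_period: "\<And>i j. 1 \<le> i \<Longrightarrow> e (j * n + i) = e i"
    and t_rel: "\<And>i. 1 \<le> i \<Longrightarrow> \<exists>a b. t * g i = \<kappa> a * g i + \<kappa> b * g (i + 1) + g (i + 2)"
    and y_rel: "\<And>i. 1 \<le> i \<Longrightarrow>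
      \<exists>a b c. y * g i = \<kappa> a * g i + \<kappa> b * g (i + 1) + \<kappa> c * g (i + 2) + g (i + 3)"
  shows "inj_on (\<lambda>i. w (g i)) {1..}"
proof -
  have pole: "order_ge k (g i)" if "1 \<le> i" "k \<le> int n - int i" for i k
    using that w_g[of i] e_cases[of i] by (auto simp: order_ge_def)
  \<comment> \<open>\<open>t * g i\<close> has order exactly \<open>n - i - 2\<close>, while
    \<open>g i\<close> and \<open>g (i + 1)\<close> have order at least \<open>n - i - 1\<close>;
    hence \<open>g (i + 2)\<close> inherits the order of \<open>t * g i\<close>.\<close>
  have step2: "e (i + 2) = 0" if i: "1 \<le> i" "e i = 0" for i
  proof -
    obtain a b where rel: "t * g i = \<kappa> a * g i + \<kappa> b * g (i + 1) + g (i + 2)"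
      using t_rel i by blast
    have wt: "w (t * g i) = int n - int i - 2"
      using i g_nz w_g t_nonzero by (simp add: w_mult w_t)
    have "g (i + 2) - t * g i = - (\<kappa> a * g i) - \<kappa> b * g (i + 1)" using rel by simp
    moreover have "order_ge (int n - int i - 1) \<dots>"
      using i by (intro order_ge_diff order_ge_uminus order_ge_const_mult pole) auto
    ultimately have "w (g (i + 2)) = w (t * g i)"
      using w_eq_of_order_ge(2)[of "t * g i" "int n - int i - 1" "g (i + 2)"] i g_nz t_nonzero wt by simp
    then show ?thesis using wt w_g[of "i + 2"] by simp
  qed
  have step3: "e (i + 3) = 0" if i: "1 \<le> i" "e i = 0" for i
  proof -
    obtain a b c where rel: "y * g i = \<kappa> a * g i + \<kappa> b * g (i + 1) + \<kappa> c * g (i + 2) + g (i + 3)"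
      using y_rel i by blast
    have wt: "w (y * g i) = int n - int i - 3"
      using i g_nz w_g y_nonzero by (simp add: w_mult w_y)
    have "g (i + 3) - y * g i = - (\<kappa> a * g i) - \<kappa> b * g (i + 1) - \<kappa> c * g (i + 2)" using rel by simp
    moreover have "order_ge (int n - int i - 2) \<dots>"
      using i by (intro order_ge_diff order_ge_uminus order_ge_const_mult pole) auto
    ultimately have "w (g (i + 3)) = w (y * g i)"
      using w_eq_of_order_ge(2)[of "y * g i" "int n - int i - 2" "g (i + 3)"] i g_nz y_nonzero wt by simp
    then show ?thesis using wt w_g[of "i + 3"] by simp
  qed
  \<comment> \<open>\<open>step2\<close> and \<open>step3\<close> reach \<open>i + 2\<close> and
    \<open>i + 3\<close>, and steps of two reach all later indices; periodicity brings the result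
    back to small \<open>k\<close>.\<close>
  have const: "e k = 0" if i: "1 \<le> i" "e i = 0" and k: "1 \<le> k" for i k
  proof -
    have "e (i + 2 + m) = 0" for m
    proof (induction m rule: less_induct)
      case (less m)
      consider "m = 0" | "m = 1" | m' where "m = m' + 2" by (metis One_nat_def add_2_eq_Suc' not0_implies_Suc)
      then show ?case
      proof cases
        case 3
        then show ?thesis using less.IH[of m'] step2[of "i + 2 + m'"] by (simp add: add.assoc)
      qed (use step2[OF i] step3[OF i] in \<open>simp_all add: eval_nat_numeral\<close>)
    qed
    \<comment> \<open>This multiple of the period moves \<open>k\<close> beyond \<open>i + 2\<close>
      without changing its excess.\<close>
    moreover have "i + 2 \<le> (i + 2) * n + k" using n by (cases n) auto
    ultimately have "e ((i + 2) * n + k) = 0" by (metis le_Suc_ex)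
    then show ?thesis using e_period[of k "i + 2"] k by simp
  qed
  \<comment> \<open>The excess is constantly 0 or constantly 1, so the orders strictly decrease with
    the index.\<close>
  have e_eq: "e i = e j" if "1 \<le> i" "1 \<le> j" for i j
    using const[of i j] const[of j i] e_cases[of i] e_cases[of j] that by metis
  show ?thesis
  proof (rule inj_onI)
    fix i j assume "i \<in> {1::nat..}" "j \<in> {1::nat..}" and eq: "w (g i) = w (g j)"
    then have i: "1 \<le> i" "1 \<le> j" by simp_all
    show "i = j" using eq w_g[OF i(1)] w_g[OF i(2)] e_eq[OF i] by simp
  qed
qed

section \<open>Twisted polynomials acting on functions\<close>

lemma field_hom_funpow: "field_hom (h :: 'a::field \<Rightarrow> 'a) \<Longrightarrow> field_hom (h ^^ j)"
proof -
  assume "field_hom h"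
  then interpret field_hom h .
  show ?thesis
  proof unfold_locales
    show "(h ^^ j) 0 = 0" by (induction j) simp_all
    show "(h ^^ j) 1 = 1" by (induction j) simp_all
    show "(h ^^ j) (x + y) = (h ^^ j) x + (h ^^ j) y" for x y by (induction j) (simp_all add: hom_add)
    show "(h ^^ j) (x * y) = (h ^^ j) x * (h ^^ j) y" for x y by (induction j) (simp_all add: hom_mult)
  qed
qed

section \<open>Coefficients of twisted polynomials\<close>

lemma twisted_poly_ring_sel:
  fixes S :: "'c::field set" and q n :: nat
  defines "R \<equiv> twisted_poly_ring q n S"
  shows "\<one>\<^bsub>R\<^esub> = scalar_tp n 1" "\<zero>\<^bsub>R\<^esub> = scalar_tp n 0" "P \<oplus>\<^bsub>R\<^esub> Q = (\<lambda>i. P i + Q i)"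
    "P \<otimes>\<^bsub>R\<^esub> Q =
      (\<lambda>k. mat n n (\<lambda>(r, s). \<Sum>i\<le>k. (P i * twist_mat q i (Q (k - i))) $$ (r, s)))"
  by (auto simp: R_def twisted_poly_ring_def scalar_tp_def fun_eq_iff)

lemma carrier_twisted_poly_ring_iff:
  "P \<in> carrier (twisted_poly_ring q n S) \<longleftrightarrow>
   (\<forall>i. P i \<in> carrier_mat n n) \<and> (\<forall>i. \<forall>r<n. \<forall>s<n. P i $$ (r, s) \<in> S) \<and>
   (\<exists>N. \<forall>i\<ge>N. P i = 0\<^sub>m n n)"
proof -
  have "finite {i. P i \<noteq> 0\<^sub>m n n} \<longleftrightarrow> (\<exists>N. \<forall>i\<ge>N. P i = 0\<^sub>m n n)"
    unfolding finite_nat_set_iff_bounded by (auto simp: not_less[symmetric])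
  moreover have "elements_mat (P i) \<subseteq> S \<longleftrightarrow> (\<forall>r<n. \<forall>s<n. P i $$ (r, s) \<in> S)"
    if "P i \<in> carrier_mat n n" for i
    using that by (force dest!: elements_matD)
  ultimately have "(\<forall>i. P i \<in> carrier_mat n n \<and> elements_mat (P i) \<subseteq> S) \<and> finite {i. P i \<noteq> 0\<^sub>m n n} \<longleftrightarrow>
      (\<forall>i. P i \<in> carrier_mat n n) \<and> (\<forall>i. \<forall>r<n. \<forall>s<n. P i $$ (r, s) \<in> S) \<and>
      (\<exists>N. \<forall>i\<ge>N. P i = 0\<^sub>m n n)"
    by meson
  then show ?thesis by (simp add: twisted_poly_ring_def)
qed

lemma twisted_mult_index:
  assumes "\<forall>i. P i \<in> carrier_mat n n" "\<forall>i. Q i \<in> carrier_mat n n" "r < n" "s < n"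
  shows "(P \<otimes>\<^bsub>twisted_poly_ring q n S\<^esub> Q) k $$ (r, s) =
    (\<Sum>i\<le>k. \<Sum>l<n. P i $$ (r, l) * Q (k - i) $$ (l, s) ^ (q ^ i))"
proof -
  have dim: "dim_row (P i) = n" "dim_col (P i) = n" "dim_row (Q i) = n" "dim_col (Q i) = n" for i
    using assms(1,2) by (meson carrier_matD)+
  show ?thesis
    using assms(3,4)
    by (simp add: twisted_poly_ring_sel(4) twist_mat_def scalar_prod_def lessThan_atLeast0 dim)
qed

text \<open>In each summand of coefficient \<open>k\<close> either \<open>N \<le> i\<close> or
  \<open>M \<le> k - i\<close>. Positivity of \<open>q\<close> makes the powers of 0 vanish.\<close>

lemma twisted_mult_zero:
  assumes "0 < q" and P: "\<forall>i. P i \<in> carrier_mat n n" and Q: "\<forall>i. Q i \<in> carrier_mat n n"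
    and N: "\<forall>i\<ge>N. P i = 0\<^sub>m n n" and M: "\<forall>i\<ge>M. Q i = 0\<^sub>m n n" and k: "N + M \<le> k"
  shows "(P \<otimes>\<^bsub>twisted_poly_ring q n S\<^esub> Q) k = 0\<^sub>m n n"
proof (rule eq_matI)
  fix r s assume "r < dim_row (0\<^sub>m n n :: 'a mat)" "s < dim_col (0\<^sub>m n n :: 'a mat)"
  then have rs: "r < n" "s < n" by auto
  have "P i $$ (r, l) * Q (k - i) $$ (l, s) ^ (q ^ i) = 0" if "l < n" for i l
  proof (cases "N \<le> i")
    case False
    then have "M \<le> k - i" using k by simp
    then show ?thesis using M rs that assms(1) by simp
  qed (use N rs that in simp)
  then show "(P \<otimes>\<^bsub>twisted_poly_ring q n S\<^esub> Q) k $$ (r, s) = 0\<^sub>m n n $$ (r, s)"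
    unfolding twisted_mult_index[OF P Q rs] using rs by (simp add: sum.neutral del: mult_eq_0_iff)
qed (simp_all add: twisted_poly_ring_sel)

text \<open>Supplies the additive structure behind the finite sum in
  \<open>poly_in_tp\<close>.\<close>

lemma abelian_monoid_twisted_poly_ring: "abelian_monoid (twisted_poly_ring q n (UNIV :: 'c::field set))"
proof (rule abelian_monoidI)
  let ?R = "twisted_poly_ring q n (UNIV :: 'c set)"
  fix P Q T
  assume P: "P \<in> carrier ?R" and Q: "Q \<in> carrier ?R" and T: "T \<in> carrier ?R"
  then have m: "P i \<in> carrier_mat n n" "Q i \<in> carrier_mat n n" "T i \<in> carrier_mat n n" for i
    by (auto simp: carrier_twisted_poly_ring_iff)
  obtain N M where "\<forall>i\<ge>N. P i = 0\<^sub>m n n" "\<forall>i\<ge>M. Q i = 0\<^sub>m n n"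
    using P Q by (auto simp: carrier_twisted_poly_ring_iff)
  then have "\<forall>i\<ge>max N M. P i + Q i = 0\<^sub>m n n" by simp
  then have "\<exists>N. \<forall>i\<ge>N. P i + Q i = 0\<^sub>m n n" by blast
  then show "P \<oplus>\<^bsub>?R\<^esub> Q \<in> carrier ?R"
    using m by (simp add: carrier_twisted_poly_ring_iff twisted_poly_ring_sel)
  show "P \<oplus>\<^bsub>?R\<^esub> Q \<oplus>\<^bsub>?R\<^esub> T = P \<oplus>\<^bsub>?R\<^esub> (Q \<oplus>\<^bsub>?R\<^esub> T)"
    using m by (simp add: twisted_poly_ring_sel assoc_add_mat[of _ n n])
  show "\<zero>\<^bsub>?R\<^esub> \<oplus>\<^bsub>?R\<^esub> P = P"
    using m by (auto simp: twisted_poly_ring_def)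
  show "P \<oplus>\<^bsub>?R\<^esub> Q = Q \<oplus>\<^bsub>?R\<^esub> P"
    using m by (simp add: twisted_poly_ring_sel comm_add_mat[of _ n n])
qed (auto simp: carrier_twisted_poly_ring_iff twisted_poly_ring_sel scalar_tp_def)

text \<open>Each factor \<open>N\<close> moves the support one superdiagonal further away, so after
  \<open>n\<close> factors nothing is left.\<close>

lemma nilpotent_strict_upper:
  assumes N: "N \<in> carrier_mat n n" and z: "\<And>r s. r < n \<Longrightarrow> s \<le> r \<Longrightarrow> N $$ (r, s) = 0"
  shows "nilpotent_mat n N"
proof -
  have *: "(N ^\<^sub>m k) $$ (r, s) = 0" if "r < n" "s < n" "s < r + k" for k r s
    using that
  proof (induction k arbitrary: s)
    case (Suc k)
    have "(N ^\<^sub>m k) $$ (r, l) * N $$ (l, s) = 0" if "l < n" for l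
      using Suc z that by (cases "l < r + k") auto
    then have "(\<Sum>l = 0..<n. (N ^\<^sub>m k) $$ (r, l) * N $$ (l, s)) = 0" by (intro sum.neutral) simp
    then show ?case using N Suc.prems by (simp add: scalar_prod_def)
  qed (use N in auto)
  have "N ^\<^sub>m n = 0\<^sub>m n n"
    by (rule eq_matI) (use N * in auto)
  then show ?thesis using N by (auto simp: nilpotent_mat_def)
qed

section \<open>Algebra of the action on the functions \<open>g i\<close>\<close>

locale twisted_basis = \<kappa>: field_hom \<kappa> + tw: field_hom tw
  for \<kappa> :: "'c::field \<Rightarrow> 'f::field" and tw :: "'f \<Rightarrow> 'f" +
  fixes q n :: nat and f :: 'f and g :: "nat \<Rightarrow> 'f"
  assumes n_pos: "0 < n" and q_pos: "0 < q"
    and tw_const: "tw (\<kappa> c) = \<kappa> (c ^ q)"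
    and g_twist: "1 \<le> j \<Longrightarrow> 1 \<le> k \<Longrightarrow> k \<le> n \<Longrightarrow>
           g (j * n + k) = (\<Prod>l<j. (tw ^^ l) f) ^ n * (tw ^^ j) (g k)"
begin

sublocale tws: field_hom "tw ^^ j" for j
  by (rule field_hom_funpow) (rule tw.field_hom_axioms)

abbreviation R :: "(nat \<Rightarrow> 'c mat) ring" where
  "R \<equiv> twisted_poly_ring q n UNIV"

abbreviation ff :: "nat \<Rightarrow> 'f" where
  "ff j \<equiv> (\<Prod>l<j. (tw ^^ l) f)"

lemma tws_const: "(tw ^^ j) (\<kappa> c) = \<kappa> (c ^ (q ^ j))"
  by (induction j) (simp_all add: tw_const mult.commute flip: power_mult)

lemma tws_fixed: "tw b = b \<Longrightarrow> (tw ^^ j) b = b"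
  by (induction j) simp_all

text \<open>Cocycle rule for the twisted product of \<open>f\<close>: it lets successive shifts of
  the index by multiples of \<open>n\<close> be composed.\<close>

lemma ff_add: "ff (i + j) = ff i * (tw ^^ i) (ff j)"
  by (induction j) (simp_all add: tws.hom_mult funpow_add mult.assoc)

text \<open>Extends \<open>g_twist\<close> from \<open>k \<le> n\<close> to all positive
  \<open>k\<close> by splitting off the multiples of \<open>n\<close> in \<open>k\<close> and
  applying \<open>ff_add\<close>.\<close>

lemma g_shift:
  assumes "1 \<le> k"
  shows "g (i * n + k) = ff i ^ n * (tw ^^ i) (g k)"
proof -
  have base: "g (j * n + k) = ff j ^ n * (tw ^^ j) (g k)" if "1 \<le> k" "k \<le> n" for j k
    using g_twist[of j k] that by (cases "j = 0") auto
  \<comment> \<open>Dividing \<open>k - 1\<close> rather than \<open>k\<close> puts the remainder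
    into \<open>1..n\<close>, the range of the base functions.\<close>
  define j k' where "j = (k - 1) div n" and "k' = (k - 1) mod n + 1"
  have k: "k = j * n + k'" "1 \<le> k'" "k' \<le> n"
    using assms n_pos div_mult_mod_eq[of "k - 1" n] mod_less_divisor[OF n_pos, of "k - 1"]
    unfolding j_def k'_def by (simp_all add: Suc_leI)
  have "g (i * n + k) = g ((i + j) * n + k')" using k by (simp add: algebra_simps)
  also have "\<dots> = ff i ^ n * (tw ^^ i) (g k)"
    unfolding base[OF k(2,3)] k(1) ff_add
    by (simp add: power_mult_distrib tws.hom_mult tws.hom_power funpow_add mult.assoc)
  finally show ?thesis .
qed

text \<open>The shift by 1 reconciles columns counted from 0 with functions counted from 1. By
  \<open>act_eq\<close> the support may be replaced by any range containing it, so that two operands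
  can be summed together.\<close>

definition act :: "(nat \<Rightarrow> 'c mat) \<Rightarrow> nat \<Rightarrow> 'f" where
  "act P r = (\<Sum>i | P i \<noteq> 0\<^sub>m n n. \<Sum>s<n. \<kappa> (P i $$ (r, s)) * g (i * n + s + 1))"

lemma act_eq:
  assumes "\<forall>i\<ge>N. P i = 0\<^sub>m n n" "r < n"
  shows "act P r = (\<Sum>i<N. \<Sum>s<n. \<kappa> (P i $$ (r, s)) * g (i * n + s + 1))"
  unfolding act_def
  by (rule sum.mono_neutral_left) (use assms in \<open>auto simp: not_less[symmetric]\<close>)

text \<open>The part of the product coming from \<open>P i\<close> applies the \<open>i\<close>-fold
  twist of the rows of \<open>Q\<close> to shifted functions. By \<open>g_shift\<close> this is
  \<open>ff i ^ n\<close> times the twist of \<open>act Q l\<close>, that is,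
  \<open>b * g (i * n + l + 1)\<close>, because \<open>b\<close> is fixed by the twist.\<close>

lemma act_mult:
  assumes P: "P \<in> carrier R" and Q: "Q \<in> carrier R" and b: "tw b = b"
    and act_Q: "\<And>r. r < n \<Longrightarrow> act Q r = b * g (r + 1)" and r: "r < n"
  shows "act (P \<otimes>\<^bsub>R\<^esub> Q) r = b * act P r"
proof -
  have m: "\<forall>i. P i \<in> carrier_mat n n" "\<forall>i. Q i \<in> carrier_mat n n"
    using P Q by (auto simp: carrier_twisted_poly_ring_iff)
  obtain N where N: "\<forall>i\<ge>N. P i = 0\<^sub>m n n" using P by (auto simp: carrier_twisted_poly_ring_iff)
  obtain M where M: "\<forall>i\<ge>M. Q i = 0\<^sub>m n n" using Q by (auto simp: carrier_twisted_poly_ring_iff)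
  let ?PQ = "P \<otimes>\<^bsub>R\<^esub> Q"
  have ix: "?PQ k $$ (r, s) = (\<Sum>i\<le>k. \<Sum>l<n. P i $$ (r, l) * Q (k - i) $$ (l, s) ^ (q ^ i))"
    if "r < n" "s < n" for k r s
    using twisted_mult_index[OF m that] .
  \<comment> \<open>\<open>T i j\<close> is what \<open>P i\<close> and \<open>Q j\<close>
    contribute to the row.\<close>
  define T where "T = (\<lambda>i j. \<Sum>l<n. \<Sum>s<n.
    \<kappa> (P i $$ (r, l)) * (\<kappa> (Q j $$ (l, s) ^ (q ^ i)) * g ((i + j) * n + s + 1)))"
  have T0: "T i j = 0" if "i \<ge> N \<or> j \<ge> M" for i j
    using that N M r q_pos by (auto simp: T_def intro!: sum.neutral)
  have PQ0: "\<forall>k\<ge>N + M. ?PQ k = 0\<^sub>m n n"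
    using twisted_mult_zero[OF q_pos m N M] by blast
  have row: "(\<Sum>s<n. \<kappa> (?PQ k $$ (r, s)) * g (k * n + s + 1)) = (\<Sum>i\<le>k. T i (k - i))" for k
  proof -
    have "(\<Sum>s<n. \<kappa> (?PQ k $$ (r, s)) * g (k * n + s + 1)) =
      (\<Sum>s<n. \<Sum>i\<le>k. \<Sum>l<n. \<kappa> (P i $$ (r, l)) * (\<kappa> (Q (k - i) $$ (l, s) ^ (q ^ i)) * g (k * n + s + 1)))"
      using r by (intro sum.cong)
        (simp_all add: ix \<kappa>.hom_sum \<kappa>.hom_mult sum_distrib_right mult.assoc del: \<kappa>.hom_power)
    also have "\<dots> = (\<Sum>i\<le>k. \<Sum>s<n. \<Sum>l<n.
        \<kappa> (P i $$ (r, l)) * (\<kappa> (Q (k - i) $$ (l, s) ^ (q ^ i)) * g (k * n + s + 1)))"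
      by (rule sum.swap)
    also have "\<dots> = (\<Sum>i\<le>k. T i (k - i))"
      unfolding T_def by (rule sum.cong[OF refl], subst sum.swap) simp
    finally show ?thesis .
  qed
  \<comment> \<open>For fixed \<open>i\<close>, summing over all \<open>j\<close> recovers complete
    rows of \<open>Q\<close>, so that \<open>act_Q\<close> applies.\<close>
  have inner: "(\<Sum>j<M. T i j) = (\<Sum>l<n. \<kappa> (P i $$ (r, l)) * (b * g (i * n + l + 1)))" for i
  proof -
    have *: "(\<Sum>j<M. \<Sum>s<n. \<kappa> (Q j $$ (l, s) ^ (q ^ i)) * g ((i + j) * n + s + 1)) = b * g (i * n + l + 1)"
      if l: "l < n" for l
    proof -
      have "(\<Sum>j<M. \<Sum>s<n. \<kappa> (Q j $$ (l, s) ^ (q ^ i)) * g ((i + j) * n + s + 1)) =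
        (\<Sum>j<M. \<Sum>s<n. ff i ^ n * (tw ^^ i) (\<kappa> (Q j $$ (l, s)) * g (j * n + s + 1)))"
      proof (intro sum.cong refl)
        fix j s
        have "g ((i + j) * n + s + 1) = g (i * n + (j * n + s + 1))" by (simp add: algebra_simps)
        then show "\<kappa> (Q j $$ (l, s) ^ (q ^ i)) * g ((i + j) * n + s + 1) =
            ff i ^ n * (tw ^^ i) (\<kappa> (Q j $$ (l, s)) * g (j * n + s + 1))"
          using g_shift[of "j * n + s + 1" i] by (simp add: tws.hom_mult tws_const ac_simps)
      qed
      also have "\<dots> = ff i ^ n * (tw ^^ i) (act Q l)"
        by (simp only: act_eq[OF M l] tws.hom_sum sum_distrib_left)
      also have "\<dots> = b * (ff i ^ n * (tw ^^ i) (g (l + 1)))"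
        by (simp only: act_Q[OF l] tws.hom_mult tws_fixed[OF b] ac_simps)
      also have "\<dots> = b * g (i * n + l + 1)"
        using g_shift[of "l + 1" i] by simp
      finally show ?thesis .
    qed
    have "(\<Sum>j<M. T i j) = (\<Sum>l<n. \<kappa> (P i $$ (r, l)) *
        (\<Sum>j<M. \<Sum>s<n. \<kappa> (Q j $$ (l, s) ^ (q ^ i)) * g ((i + j) * n + s + 1)))"
      unfolding T_def by (subst sum.swap) (simp only: sum_distrib_left)
    then show ?thesis using * by simp
  qed
  have "act ?PQ r = (\<Sum>k<N + M. \<Sum>i\<le>k. T i (k - i))"
    unfolding act_eq[OF PQ0 r] row ..
  also have "\<dots> = (\<Sum>(i, j)\<in>{(i, j). i + j < N + M}. T i j)"
    by (rule sum.triangle_reindex[symmetric])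
  \<comment> \<open>\<open>T\<close> vanishes outside the rectangle, and the rectangle lies in the
    triangle \<open>i + j < N + M\<close>.\<close>
  also have "\<dots> = (\<Sum>(i, j)\<in>{..<N} \<times> {..<M}. T i j)"
  proof (rule sum.mono_neutral_right)
    have "{(i, j). i + j < N + M} \<subseteq> {..<N + M} \<times> {..<N + M}" by auto
    then show "finite {(i, j). i + j < N + M}" by (rule finite_subset) simp
  qed (use T0 in \<open>auto simp: not_less[symmetric]\<close>)
  also have "\<dots> = (\<Sum>i<N. \<Sum>j<M. T i j)" by (rule sum.cartesian_product[symmetric])
  also have "\<dots> = b * act P r"
    unfolding inner act_eq[OF N r] by (simp add: sum_distrib_left ac_simps)
  finally show ?thesis .
qed

text \<open>Bundles what products and sums must preserve. For \<open>\<rho>\<close> the diagonal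
  value \<open>x\<close> will be given by \<open>iota\<close>, and triangularity of the constant
  coefficient yields the nilpotent part.\<close>

definition represents :: "'c set \<Rightarrow> (nat \<Rightarrow> 'c mat) \<Rightarrow> 'f \<Rightarrow> 'c \<Rightarrow> bool" where
  "represents H P b x \<longleftrightarrow> P \<in> carrier (twisted_poly_ring q n H) \<and> tw b = b \<and>
     (\<forall>r<n. act P r = b * g (r + 1)) \<and>
     (\<forall>r<n. \<forall>s\<le>r. P 0 $$ (r, s) = (if s = r then x else 0))"

lemma represents_carrier_UNIV: "represents H P b x \<Longrightarrow> P \<in> carrier R"
  by (auto simp: represents_def carrier_twisted_poly_ring_iff)

lemma represents_mult:
  assumes H: "subring H univ_field" and P: "represents H P b x" and Q: "represents H Q c x'"
  shows "represents H (P \<otimes>\<^bsub>R\<^esub> Q) (b * c) (x * x')"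
proof -
  have m: "\<forall>i. P i \<in> carrier_mat n n" "\<forall>i. Q i \<in> carrier_mat n n"
    using P Q by (auto simp: represents_def carrier_twisted_poly_ring_iff)
  obtain N M where "\<forall>i\<ge>N. P i = 0\<^sub>m n n" "\<forall>i\<ge>M. Q i = 0\<^sub>m n n"
    using P Q by (auto simp: represents_def carrier_twisted_poly_ring_iff)
  then have "\<forall>k\<ge>N + M. (P \<otimes>\<^bsub>R\<^esub> Q) k = 0\<^sub>m n n"
    using twisted_mult_zero[OF q_pos m] by blast
  moreover have "(P \<otimes>\<^bsub>R\<^esub> Q) k $$ (r, s) \<in> H" if "r < n" "s < n" for k r s
    unfolding twisted_mult_index[OF m that] using P Q that
    by (intro subring_univ_field_sum[OF H] subring_univ_fieldD(6,7)[OF H])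
      (auto simp: represents_def carrier_twisted_poly_ring_iff)
  ultimately have "P \<otimes>\<^bsub>R\<^esub> Q \<in> carrier (twisted_poly_ring q n H)"
    by (auto simp: carrier_twisted_poly_ring_iff twisted_poly_ring_sel(4))
  moreover have "act (P \<otimes>\<^bsub>R\<^esub> Q) r = b * c * g (r + 1)" if "r < n" for r
    using act_mult[OF represents_carrier_UNIV[OF P] represents_carrier_UNIV[OF Q], of c r] P Q that
    by (simp add: represents_def)
  moreover have "(P \<otimes>\<^bsub>R\<^esub> Q) 0 $$ (r, s) = (if s = r then x * x' else 0)" if "r < n" "s \<le> r" for r s
  proof -
    have s: "s < n" using that by simp
    \<comment> \<open>Triangularity kills \<open>l < r\<close> through \<open>P\<close> and
      \<open>l > r\<close> through \<open>Q\<close>, leaving \<open>l = r\<close>; in degree 0 the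
      twist is trivial.\<close>
    have "P 0 $$ (r, l) * Q 0 $$ (l, s) = (if l = r then if s = r then x * x' else 0 else 0)" if "l < n" for l
      using that P Q \<open>r < n\<close> \<open>s \<le> r\<close> by (cases l r rule: linorder_cases) (auto simp: represents_def)
    then show ?thesis using that by (simp add: twisted_mult_index[OF m that(1) s])
  qed
  ultimately show ?thesis using P Q by (auto simp: represents_def tw.hom_mult)
qed

lemma represents_add:
  assumes H: "subring H univ_field" and P: "represents H P b x" and Q: "represents H Q c x'"
  shows "represents H (P \<oplus>\<^bsub>R\<^esub> Q) (b + c) (x + x')"
proof -
  have m: "P i \<in> carrier_mat n n" "Q i \<in> carrier_mat n n" for i
    using P Q by (auto simp: represents_def carrier_twisted_poly_ring_iff)
  obtain N M where N: "\<forall>i\<ge>N. P i = 0\<^sub>m n n" and M: "\<forall>i\<ge>M. Q i = 0\<^sub>m n n"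
    using P Q by (auto simp: represents_def carrier_twisted_poly_ring_iff)
  have PQ: "\<forall>i\<ge>max N M. P i = 0\<^sub>m n n" "\<forall>i\<ge>max N M. Q i = 0\<^sub>m n n"
    "\<forall>i\<ge>max N M. (P \<oplus>\<^bsub>R\<^esub> Q) i = 0\<^sub>m n n"
    using N M by (auto simp: twisted_poly_ring_sel(3))
  have "(P i + Q i) $$ (r, s) = P i $$ (r, s) + Q i $$ (r, s)" if "r < n" "s < n" for i r s
    using m[of i] that by simp
  note ix = this
  have "act (P \<oplus>\<^bsub>R\<^esub> Q) r = act P r + act Q r" if "r < n" for r
    using ix that unfolding act_eq[OF PQ(1) that] act_eq[OF PQ(2) that] act_eq[OF PQ(3) that]
    by (simp add: twisted_poly_ring_sel(3) \<kappa>.hom_add sum.distrib distrib_right)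
  moreover have "P \<oplus>\<^bsub>R\<^esub> Q \<in> carrier (twisted_poly_ring q n H)"
    unfolding carrier_twisted_poly_ring_iff
  proof (intro conjI)
    show "\<forall>i. \<forall>r<n. \<forall>s<n. (P \<oplus>\<^bsub>R\<^esub> Q) i $$ (r, s) \<in> H"
      using P Q subring_univ_fieldD(4)[OF H]
      by (auto simp: twisted_poly_ring_sel(3) ix represents_def carrier_twisted_poly_ring_iff
          simp del: index_add_mat)
    show "\<exists>N. \<forall>i\<ge>N. (P \<oplus>\<^bsub>R\<^esub> Q) i = 0\<^sub>m n n" using PQ(3) by blast
  qed (use m in \<open>simp add: twisted_poly_ring_sel(3)\<close>)
  moreover have "(P \<oplus>\<^bsub>R\<^esub> Q) 0 $$ (r, s) = (if s = r then x + x' else 0)" if "r < n" "s \<le> r" for r s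
    using ix[of r s 0] that P Q by (simp add: represents_def twisted_poly_ring_sel(3) del: index_add_mat)
  ultimately show ?thesis using P Q
    by (simp add: represents_def tw.hom_add distrib_right)
qed

lemma represents_scalar:
  assumes H: "subring H univ_field" and c: "c \<in> H" "c ^ q = c"
  shows "represents H (scalar_tp n c) (\<kappa> c) c"
proof -
  have z: "\<forall>i\<ge>1. scalar_tp n c i = 0\<^sub>m n n" by (simp add: scalar_tp_def)
  have "act (scalar_tp n c) r = \<kappa> c * g (r + 1)" if "r < n" for r
  proof -
    have "\<kappa> (scalar_tp n c 0 $$ (r, s)) * g (0 * n + s + 1) = (if s = r then \<kappa> c * g (r + 1) else 0)"
      if "s < n" for s
      using that \<open>r < n\<close> by (auto simp: scalar_tp_def)
    then have "act (scalar_tp n c) r = (\<Sum>s<n. if s = r then \<kappa> c * g (r + 1) else 0)"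
      unfolding act_eq[OF z that] by simp
    then show ?thesis using that by simp
  qed
  moreover have "scalar_tp n c \<in> carrier (twisted_poly_ring q n H)"
    using z c subring_univ_fieldD(1)[OF H]
    unfolding carrier_twisted_poly_ring_iff by (auto simp: scalar_tp_def)
  ultimately show ?thesis using c
    by (auto simp: represents_def tw_const scalar_tp_def)
qed

lemma represents_one:
  assumes "subring H univ_field"
  shows "represents H \<one>\<^bsub>R\<^esub> 1 1"
  using represents_scalar[OF assms, of 1] subring_univ_fieldD(2)[OF assms]
  by (simp add: twisted_poly_ring_sel)

lemma represents_power:
  assumes "subring H univ_field" "represents H P b x"
  shows "represents H (P [^]\<^bsub>R\<^esub> (k :: nat)) (b ^ k) (x ^ k)"
proof (induction k)
  case 0
  then show ?case using represents_one[OF assms(1)] by (simp add: nat_pow_def)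
next
  case (Suc k)
  have "P [^]\<^bsub>R\<^esub> Suc k = P [^]\<^bsub>R\<^esub> k \<otimes>\<^bsub>R\<^esub> P" by (simp add: nat_pow_def)
  then show ?case using represents_mult[OF assms(1) Suc assms(2)] by (simp add: mult.commute)
qed

lemma represents_poly_in_tp:
  assumes H: "subring H univ_field" and P: "represents H P b x"
    and c: "\<And>i. coeff c i \<in> H" "\<And>i. coeff c i ^ q = coeff c i"
  shows "represents H (poly_in_tp q n c P) (poly (map_poly \<kappa> c) b) (poly c x)"
proof -
  interpret abelian_monoid R by (rule abelian_monoid_twisted_poly_ring)
  define F where "F = (\<lambda>i. scalar_tp n (coeff c i) \<otimes>\<^bsub>R\<^esub> (P [^]\<^bsub>R\<^esub> i))"
  have F: "represents H (F i) (\<kappa> (coeff c i) * b ^ i) (coeff c i * x ^ i)" for i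
    unfolding F_def by (intro represents_mult[OF H] represents_scalar[OF H] represents_power[OF H] P c)
  have car: "F \<in> A \<rightarrow> carrier R" for A
    using represents_carrier_UNIV[OF F] by blast
  have "represents H (finsum R F {..k}) (\<Sum>i\<le>k. \<kappa> (coeff c i) * b ^ i) (\<Sum>i\<le>k. coeff c i * x ^ i)" for k
  proof (induction k)
    case 0
    have "finsum R F {..0} = F 0" by (rule finsum_0[OF car])
    then show ?case using F[of 0] by (simp only: atMost_0 sum.insert finite.emptyI empty_iff sum.empty) simp
  next
    case (Suc k)
    then show ?case using represents_add[OF H F[of "Suc k"] Suc] car
      by (simp add: finsum_Suc add.commute)
  qed
  then show ?thesis
    by (simp add: poly_in_tp_def Let_def F_def poly_altdef degree_map_poly coeff_map_poly)
qed

text \<open>A row of \<open>P - Q\<close> is a coefficient vector over the functions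
  \<open>g (i * n + s + 1)\<close>, and equal actions make its combination vanish. This converts
  identities between functions into identities between twisted polynomials.\<close>

lemma represents_unique:
  assumes indep: "\<And>J c i s. finite J \<Longrightarrow> J \<subseteq> UNIV \<times> {..<n} \<Longrightarrow>
      (\<Sum>(i, s)\<in>J. \<kappa> (c (i, s)) * g (i * n + s + 1)) = 0 \<Longrightarrow> (i, s) \<in> J \<Longrightarrow> c (i, s) = 0"
    and P: "represents H P b x" and Q: "represents H' Q b x'"
  shows "P = Q"
proof (rule ext)
  fix i
  have m: "P i \<in> carrier_mat n n" "Q i \<in> carrier_mat n n" for i
    using P Q by (auto simp: represents_def carrier_twisted_poly_ring_iff)
  obtain N M where N: "\<forall>i\<ge>N. P i = 0\<^sub>m n n" and M: "\<forall>i\<ge>M. Q i = 0\<^sub>m n n"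
    using P Q by (auto simp: represents_def carrier_twisted_poly_ring_iff)
  have PQ: "\<forall>i\<ge>max N M. P i = 0\<^sub>m n n" "\<forall>i\<ge>max N M. Q i = 0\<^sub>m n n"
    using N M by auto
  have "P i $$ (r, s) = Q i $$ (r, s)" if rs: "r < n" "s < n" "i < max N M" for r s
  proof -
    let ?c = "\<lambda>(i, s). P i $$ (r, s) - Q i $$ (r, s)"
    have "(\<Sum>(i, s)\<in>{..<max N M} \<times> {..<n}. \<kappa> (?c (i, s)) * g (i * n + s + 1)) = act P r - act Q r"
      unfolding act_eq[OF PQ(1) rs(1)] act_eq[OF PQ(2) rs(1)] sum.cartesian_product[symmetric]
      by (simp add: \<kappa>.hom_minus algebra_simps sum_subtractf)
    also have "\<dots> = 0" using P Q rs by (simp add: represents_def)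
    finally have "?c (i, s) = 0" by (rule indep[rotated 2]) (use rs in auto)
    then show ?thesis by simp
  qed
  moreover have "P i = Q i" if "\<not> i < max N M"
    using PQ that by (metis not_less)
  moreover have "dim_row (P i) = n" "dim_col (P i) = n" "dim_row (Q i) = n" "dim_col (Q i) = n"
    using m[of i] by auto
  ultimately show "P i = Q i" by (metis eq_matI)
qed

section \<open>Rows of \<open>rho_t\<close> and \<open>rho_y\<close> and the relations for all
  indices\<close>

lemma sum_band:
  assumes "r < n"
    and "\<forall>s<n. c s = (if s = r then A else if s = r + 1 then B else if s = r + 2 then C
            else if s = r + 3 then D else 0)"
  shows "(\<Sum>s<n. \<kappa> (c s) * G s) =
    \<kappa> A * G r + (if r + 1 < n then \<kappa> B * G (r + 1) else 0) +
    (if r + 2 < n then \<kappa> C * G (r + 2) else 0) + (if r + 3 < n then \<kappa> D * G (r + 3) else 0)"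
proof -
  have "\<kappa> (c s) * G s =
    (if s = r then \<kappa> A * G r else 0) + (if s = r + 1 then \<kappa> B * G (r + 1) else 0) +
    (if s = r + 2 then \<kappa> C * G (r + 2) else 0) + (if s = r + 3 then \<kappa> D * G (r + 3) else 0)"
    if "s < n" for s
    using assms(2) that by auto
  then have "(\<Sum>s<n. \<kappa> (c s) * G s) = (\<Sum>s<n.
    (if s = r then \<kappa> A * G r else 0) + (if s = r + 1 then \<kappa> B * G (r + 1) else 0) +
    (if s = r + 2 then \<kappa> C * G (r + 2) else 0) + (if s = r + 3 then \<kappa> D * G (r + 3) else 0))"
    by (intro sum.cong) auto
  then show ?thesis
    using assms(1) by (simp only: sum.distrib sum.delta finite_lessThan lessThan_iff if_True)
qed

text \<open>The rows of \<open>d_theta\<close> supply the terms of the relations up to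
  \<open>g n\<close>; those cut off by the edge of the matrix are \<open>g (n + 1)\<close> and
  \<open>g (n + 2)\<close>, which belong to the first two columns of \<open>E_theta\<close>.\<close>

lemma represents_rho_t:
  assumes n: "2 \<le> n" and H: "subring H univ_field" and \<theta>: "\<theta> \<in> H"
    and a: "\<And>i. 1 \<le> i \<Longrightarrow> i \<le> n \<Longrightarrow> a i \<in> H" and t: "tw t = t"
    and rel: "\<And>i. 1 \<le> i \<Longrightarrow> i \<le> n \<Longrightarrow> t * g i = \<kappa> \<theta> * g i + \<kappa> (a i) * g (i + 1) + g (i + 2)"
  shows "represents H (rho_t n \<theta> a) t \<theta>"
proof -
  note H01 = subring_univ_fieldD(1,2)[OF H]
  have z: "\<forall>i\<ge>2. rho_t n \<theta> a i = 0\<^sub>m n n" by (simp add: rho_t_def)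
  have d: "\<forall>s<n. d_theta n \<theta> a $$ (r, s) = (if s = r then \<theta> else if s = r + 1 then a (r + 1)
      else if s = r + 2 then 1 else if s = r + 3 then 0 else 0)" if "r < n" for r
    using that by (simp add: d_theta_def)
  \<comment> \<open>Every row of \<open>E_theta\<close> is read as a band starting in column 0, the
    case \<open>r = 0\<close> of \<open>sum_band\<close>; the sums \<open>0 + 1\<close> to
    \<open>0 + 3\<close> match its pattern.\<close>
  have e: "\<forall>s<n. E_theta n a $$ (r, s) = (if s = 0 then if r + 2 = n then 1 else if r + 1 = n then a n else 0
      else if s = 0 + 1 then if r + 1 = n then 1 else 0
      else if s = 0 + 2 then 0 else if s = 0 + 3 then 0 else 0)" if "r < n" for r
    using that by (simp add: E_theta_def)
  have "act (rho_t n \<theta> a) r = t * g (r + 1)" if r: "r < n" for r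
  proof -
    have "act (rho_t n \<theta> a) r =
      (\<Sum>s<n. \<kappa> (d_theta n \<theta> a $$ (r, s)) * g (s + 1)) + (\<Sum>s<n. \<kappa> (E_theta n a $$ (r, s)) * g (n + s + 1))"
      unfolding act_eq[OF z r] by (simp add: eval_nat_numeral rho_t_def)
    also have "\<dots> = t * g (r + 1)"
      unfolding sum_band[OF r d[OF r]] sum_band[OF n_pos e[OF r]] using r n rel[of "r + 1"]
      by (cases rule: linorder_cases[of "r + 2" n]; cases "n = r + 1") (auto simp: eval_nat_numeral)
    finally show ?thesis .
  qed
  moreover have "rho_t n \<theta> a \<in> carrier (twisted_poly_ring q n H)"
    unfolding carrier_twisted_poly_ring_iff
  proof (intro conjI allI impI)
    show "\<exists>N. \<forall>i\<ge>N. rho_t n \<theta> a i = 0\<^sub>m n n" using z by blast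
    show "rho_t n \<theta> a i $$ (r, s) \<in> H" if "r < n" "s < n" for i r s
      using that H01 \<theta> a n by (simp add: rho_t_def d_theta_def E_theta_def)
  qed (simp add: rho_t_def d_theta_def E_theta_def)
  moreover have "rho_t n \<theta> a 0 $$ (r, s) = (if s = r then \<theta> else 0)" if "r < n" "s \<le> r" for r s
    using that by (simp add: rho_t_def d_theta_def)
  ultimately show ?thesis using t by (simp add: represents_def)
qed

lemma represents_rho_y:
  assumes n: "2 \<le> n" and H: "subring H univ_field" and \<eta>: "\<eta> \<in> H"
    and yz: "\<And>i. 1 \<le> i \<Longrightarrow> i \<le> n \<Longrightarrow> yc i \<in> H \<and> zc i \<in> H" and y: "tw y = y"
    and rel: "\<And>i. 1 \<le> i \<Longrightarrow> i \<le> n \<Longrightarrow>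
      y * g i = \<kappa> \<eta> * g i + \<kappa> (yc i) * g (i + 1) + \<kappa> (zc i) * g (i + 2) + g (i + 3)"
  shows "represents H (rho_y n \<eta> yc zc) y \<eta>"
proof -
  note H01 = subring_univ_fieldD(1,2)[OF H]
  have z: "\<forall>i\<ge>3. rho_y n \<eta> yc zc i = 0\<^sub>m n n" by (simp add: rho_y_def)
  have d: "\<forall>s<n. d_eta n \<eta> yc zc $$ (r, s) = (if s = r then \<eta> else if s = r + 1 then yc (r + 1)
      else if s = r + 2 then zc (r + 1) else if s = r + 3 then 1 else 0)" if "r < n" for r
    using that by (simp add: d_eta_def)
  have e: "\<forall>s<n. E_eta n yc zc $$ (r, s) = (if s = 0 then if r + 3 = n then 1 else if r + 2 = n then zc (n - 1)
        else if r + 1 = n then yc n else 0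
      else if s = 0 + 1 then if r + 2 = n then 1 else if r + 1 = n then zc n else 0
      else if s = 0 + 2 then if r + 1 = n then 1 else 0 else if s = 0 + 3 then 0 else 0)"
    if "r < n" for r
    using that by (simp add: E_eta_def)
  \<comment> \<open>For \<open>n = 2\<close> the relation for \<open>y * g 2\<close> ends in
    \<open>g 5 = g (2 * n + 1)\<close>, which belongs to the first column of the coefficient of
    \<open>\<tau>\<^sup>2\<close>.\<close>
  have e2: "\<forall>s<n. rho_y n \<eta> yc zc 2 $$ (r, s) = (if s = 0 then if n = 2 \<and> r = 1 then 1 else 0 else if s = 0 + 1 then 0
      else if s = 0 + 2 then 0 else if s = 0 + 3 then 0 else 0)"
    if "r < n" for r
    using that by (simp add: rho_y_def)
  have "act (rho_y n \<eta> yc zc) r = y * g (r + 1)" if r: "r < n" for r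
  proof -
    have "act (rho_y n \<eta> yc zc) r =
      (\<Sum>s<n. \<kappa> (d_eta n \<eta> yc zc $$ (r, s)) * g (s + 1)) + (\<Sum>s<n. \<kappa> (E_eta n yc zc $$ (r, s)) * g (n + s + 1))
      + (\<Sum>s<n. \<kappa> (rho_y n \<eta> yc zc 2 $$ (r, s)) * g (2 * n + s + 1))"
    proof -
      have "{..<3} = {0, 1, 2 :: nat}" by auto
      then show ?thesis unfolding act_eq[OF z r] by (simp add: rho_y_def[of n \<eta> yc zc] add.assoc)
    qed
    \<comment> \<open>The cases count how many terms of the relation pass the edge of
      \<open>d_eta\<close>: none, one, two or three.\<close>
    also have "\<dots> = y * g (r + 1)"
      unfolding sum_band[OF r d[OF r]] sum_band[OF n_pos e[OF r]] sum_band[OF n_pos e2[OF r]]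
      using r n rel[of "r + 1"]
      by (cases rule: linorder_cases[of "r + 3" n]; cases "n = r + 2"; cases "n = r + 1")
        (auto simp: eval_nat_numeral)
    finally show ?thesis .
  qed
  moreover have "rho_y n \<eta> yc zc \<in> carrier (twisted_poly_ring q n H)"
    unfolding carrier_twisted_poly_ring_iff
  proof (intro conjI allI impI)
    show "\<exists>N. \<forall>i\<ge>N. rho_y n \<eta> yc zc i = 0\<^sub>m n n" using z by blast
    show "rho_y n \<eta> yc zc i $$ (r, s) \<in> H" if "r < n" "s < n" for i r s
      using that H01 \<eta> yz n by (simp add: rho_y_def d_eta_def E_eta_def)
  qed (simp add: rho_y_def d_eta_def E_eta_def)
  moreover have "rho_y n \<eta> yc zc 0 $$ (r, s) = (if s = r then \<eta> else 0)" if "r < n" "s \<le> r" for r s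
    using that by (simp add: rho_y_def d_eta_def)
  ultimately show ?thesis using y by (simp add: represents_def)
qed

text \<open>Multiplying the \<open>j\<close>-fold twist of a base relation by
  \<open>ff j ^ n\<close> shifts its indices by \<open>j * n\<close> and raises its constants to the
  power \<open>q ^ j\<close>. Four coefficients accommodate both the \<open>t\<close> and the
  \<open>y\<close> relation.\<close>

lemma relation_shift:
  assumes "1 \<le> i"
    and "\<And>k. 1 \<le> k \<Longrightarrow> k \<le> n \<Longrightarrow> u * g k = \<kappa> (A k) * g k + \<kappa> (B k) * g (k + 1) + \<kappa> (C k) * g (k + 2) + \<kappa> (D k) * g (k + 3)"
    and "tw u = u"
  shows "\<exists>j k. 1 \<le> k \<and> k \<le> n \<and> u * g i = \<kappa> (A k ^ (q ^ j)) * g i + \<kappa> (B k ^ (q ^ j)) * g (i + 1) +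
    \<kappa> (C k ^ (q ^ j)) * g (i + 2) + \<kappa> (D k ^ (q ^ j)) * g (i + 3)"
proof -
  define j k where "j = (i - 1) div n" and "k = (i - 1) mod n + 1"
  have i: "i = j * n + k" and k: "1 \<le> k" "k \<le> n"
    using assms(1) n_pos div_mult_mod_eq[of "i - 1" n] mod_less_divisor[OF n_pos, of "i - 1"]
    unfolding j_def k_def by (simp_all add: Suc_leI)
  have g: "g (i + l) = ff j ^ n * (tw ^^ j) (g (k + l))" for l
    using g_shift[of "k + l" j] k unfolding i by (simp add: add.assoc)
  have g0: "g i = ff j ^ n * (tw ^^ j) (g k)" using g[of 0] by simp
  have "u * g i = ff j ^ n * (tw ^^ j) (u * g k)"
    unfolding g0 by (simp add: tws.hom_mult tws_fixed[OF assms(3)])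
  also have "\<dots> = \<kappa> (A k ^ (q ^ j)) * g i + \<kappa> (B k ^ (q ^ j)) * g (i + 1) +
    \<kappa> (C k ^ (q ^ j)) * g (i + 2) + \<kappa> (D k ^ (q ^ j)) * g (i + 3)"
    unfolding assms(2)[OF k] g g0
    by (simp add: tws.hom_mult tws.hom_add tws_const algebra_simps del: \<kappa>.hom_power)
  finally show ?thesis using k by blast
qed

end

section \<open>The tensor power as an Anderson module\<close>

lemma has_divisor_order_at_infinity:
  assumes "has_divisor E \<kappa> t y h D"
  obtains w where "is_order_at \<kappa> t y Infinity w" "w h = Poly_Mapping.lookup D Infinity"
  using assms by (auto simp: has_divisor_def curve_points_def)

lemma transcendental_nonzero:
  assumes "subring S univ_field" "ring.transcendental univ_field S (x :: 'a::field)"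
  shows "x \<noteq> 0"
proof
  assume "x = 0"
  interpret field "univ_field :: 'a ring" by (rule field_univ_field)
  show False using zero_is_algebraic[OF assms(1)] assms(2) \<open>x = 0\<close> by (simp add: over_def)
qed

theorem proposition4p6:
  fixes q n :: nat
    and Fq K H :: "'c::{alg_closed_field,complete_space} set"
    and E :: "'c weierstrass"
    and \<theta> \<eta> \<alpha> \<beta> :: 'c
    and \<kappa> :: "'c \<Rightarrow> 'f::field" and t y f :: 'f and tw :: "'f \<Rightarrow> 'f"
    and V V1 \<Xi> :: "'c point"
    and g :: "nat \<Rightarrow> 'f"
    and a yc zc :: "nat \<Rightarrow> 'c"
    and Hty :: "'f set"
  assumes "n \<ge> 2"
    and "elliptic_base q Fq E \<theta> \<eta>"
    and "elliptic_function_field q E \<kappa> t y tw"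
    and "K = generate_field univ_field (Fq \<union> {\<theta>, \<eta>})"
    and "is_hilbert_class_field K (closure K) H"
    and "Hty = generate_field univ_field (\<kappa> ` H \<union> {t, y})"
    and "\<Xi> = Affine \<theta> \<eta>"
    and "V = Affine \<alpha> \<beta>" and "V1 = frobenius_point q V"
    and "V \<in> curve_points E" and "\<alpha> \<in> H" and "\<beta> \<in> H"
    and "inf_deg q \<alpha> > 0" and "inf_deg q \<beta> > 0"
    and "point_add E V (point_neg E V1) = \<Xi>"
    and "f \<in> Hty" and "has_sign \<kappa> t y f 1"
    and "has_divisor E \<kappa> t y f
           (div_pt V1 1 - div_pt V 1 + div_pt \<Xi> 1 - div_pt Infinity 1)"
    and "\<And>j. 1 \<le> j \<Longrightarrow> j \<le> n \<Longrightarrow> g j \<in> Hty \<and> has_sign \<kappa> t y (g j) 1 \<and>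
           has_divisor E \<kappa> t y (g j)
             (- div_pt V (int n) + div_pt Infinity (int n - int j) + div_pt \<Xi> (int j - 1)
              + div_pt (point_add E (point_mult E (j - 1) V1)
                                    (point_mult E (n - (j - 1)) V)) 1)"
    and "\<And>j k. 1 \<le> j \<Longrightarrow> 1 \<le> k \<Longrightarrow> k \<le> n \<Longrightarrow>
           g (j * n + k) = (\<Prod>l<j. (tw ^^ l) f) ^ n * (tw ^^ j) (g k)"
    and "\<And>i. 1 \<le> i \<Longrightarrow> i \<le> n \<Longrightarrow> a i \<in> H \<and> yc i \<in> H \<and> zc i \<in> H"
    and "\<And>i. 1 \<le> i \<Longrightarrow> i \<le> n \<Longrightarrow>
           t * g i = \<kappa> \<theta> * g i + \<kappa> (a i) * g (i + 1) + g (i + 2)"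
    and "\<And>i. 1 \<le> i \<Longrightarrow> i \<le> n \<Longrightarrow>
           y * g i = \<kappa> \<eta> * g i + \<kappa> (yc i) * g (i + 1) + \<kappa> (zc i) * g (i + 2) + g (i + 3)"
  shows "anderson_module q Fq \<theta> \<eta> \<kappa> t y n (rho_tensor q Fq \<theta> \<eta> \<kappa> t y n a yc zc) \<and>
         rho_tensor q Fq \<theta> \<eta> \<kappa> t y n a yc zc ` A_ring Fq \<kappa> t y
           \<subseteq> carrier (twisted_poly_ring q n H)"
proof -
  interpret B: elliptic_base q Fq E \<theta> \<eta> by (rule assms(2))
  interpret F: elliptic_function_field q E \<kappa> t y tw by (rule assms(3))
  have n: "0 < n" using assms(1) by simp
  have Fq: "subring Fq univ_field" by (rule subfield_univ_field_subring[OF B.Fq_subfield])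
  have q: "0 < q" using subring_univ_fieldD(1)[OF Fq] B.Fq_finite B.Fq_card by (auto simp: card_gt_0_iff)
  have H: "subring H univ_field" and "K \<subseteq> H"
    using assms(5) subfield_univ_field_subring[of H]
    by (auto simp: is_hilbert_class_field_def finite_abelian_extension_def)
  moreover have "Fq \<union> {\<theta>, \<eta>} \<subseteq> K" unfolding assms(4) by (auto intro: generate_field.incl)
  ultimately have FqH: "Fq \<subseteq> H" and \<theta>H: "\<theta> \<in> H" and \<eta>H: "\<eta> \<in> H" by auto
  have \<kappa>: "field_hom \<kappa>" and tw: "field_hom tw"
    using field_hom_univ_field F.\<kappa>_hom F.tw_hom by blast+
  interpret twisted_basis \<kappa> tw q n f g
    by (intro twisted_basis.intro twisted_basis_axioms.intro \<kappa> tw n q F.tw_const assms(20))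
  \<comment> \<open>Over a subring 0 is algebraic, so the transcendental \<open>t\<close> is
    nonzero.\<close>
  have "subring (range \<kappa>) univ_field"
  proof -
    interpret ring "univ_field :: 'f ring" by (rule field.is_ring[OF field_univ_field])
    show ?thesis
      by (rule subringI) (auto simp flip: \<kappa>.hom_add \<kappa>.hom_mult \<kappa>.hom_uminus intro: range_eqI[of _ _ 1])
  qed
  then have t: "t \<noteq> 0" using transcendental_nonzero F.t_transcendental by blast
  \<comment> \<open>\<open>V\<close>, \<open>V1\<close> and \<open>\<Xi>\<close> are affine, so only
    the summand at \<open>Infinity\<close> counts. The valuation chosen here for \<open>f\<close>
    serves for all later functions.\<close>
  obtain w where w: "is_order_at \<kappa> t y Infinity w" and w_f: "w f = - 1"
    by (rule has_divisor_order_at_infinity[OF assms(18)])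
      (auto simp: assms(7-9) lookup_add lookup_minus lookup_single)
  interpret order_at_infinity_generated \<kappa> E t y w
    by unfold_locales (use F.t_y_eq t w F.generated in auto)
  have f: "f \<noteq> 0" using assms(18) by (simp add: has_divisor_def)

  have w_tws: "w ((tw ^^ l) u) = w u" if "u \<noteq> 0" for l u
    using that by (induction l) (simp_all add: w_twist[OF tw F.tw_const F.tw_t F.tw_y])
  have w_ff: "ff j \<noteq> 0 \<and> w (ff j) = - int j" for j
    using f by (induction j) (simp_all add: w_mult w_tws w_f)
  \<comment> \<open>The last point in the divisor of \<open>g k\<close> is affine or
    \<open>Infinity\<close>; in the second case the order grows by 1.\<close>
  have g_base: "g k \<noteq> 0 \<and> (w (g k) = int n - int k \<or> w (g k) = int n - int k + 1)"
    if k: "1 \<le> k" "k \<le> n" for k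
  proof -
    have div: "has_divisor E \<kappa> t y (g k)
             (- div_pt V (int n) + div_pt Infinity (int n - int k) + div_pt \<Xi> (int k - 1)
              + div_pt (point_add E (point_mult E (k - 1) V1) (point_mult E (n - (k - 1)) V)) 1)"
      using assms(19)[OF k] by blast
    then have g: "g k \<noteq> 0" by (simp add: has_divisor_def)
    obtain w' where "is_order_at \<kappa> t y Infinity w'" and w': "w' (g k) = int n - int k \<or> w' (g k) = int n - int k + 1"
      by (rule has_divisor_order_at_infinity[OF div])
        (auto simp: assms(7-9) lookup_add lookup_minus lookup_uminus lookup_single when_def split: if_splits)
    then have "w' (g k) = w (g k)" using w_unique g by blast
    then show ?thesis using g w' by simp
  qed
  have dec: "\<exists>j k. i = j * n + k \<and> 1 \<le> k \<and> k \<le> n" if "1 \<le> i" for i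
    using that n div_mult_mod_eq[of "i - 1" n] mod_less_divisor[OF n, of "i - 1"]
    by (intro exI[of _ "(i - 1) div n"] exI[of _ "(i - 1) mod n + 1"]) (simp add: Suc_leI)
  have g_nz: "g i \<noteq> 0" if "1 \<le> i" for i
    using dec[OF that] g_shift g_base w_ff by auto
  define e where "e = (\<lambda>i. w (g i) - int n + int i)"
  \<comment> \<open>\<open>ff j ^ n\<close> has order \<open>- j * n\<close>, which cancels the
    change of the index by \<open>j * n\<close>.\<close>
  have e_period: "e (j * n + i) = e i" if "1 \<le> i" for i j
  proof -
    have ff: "ff j \<noteq> 0" "w (ff j) = - int j" using w_ff by blast+
    have "w (g (j * n + i)) = int n * w (ff j) + w (g i)"
      unfolding g_shift[OF that] using g_nz[OF that] ff(1)
      by (simp add: w_mult w_power w_tws del: prod_zero_iff)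
    then show ?thesis by (simp add: e_def ff(2))
  qed
  have e_cases: "e i = 0 \<or> e i = 1" if i: "1 \<le> i" for i
  proof -
    obtain j k where "i = j * n + k" "1 \<le> k" "k \<le> n" using dec[OF i] by blast
    then show ?thesis using e_period[of k j] g_base[of k] by (auto simp: e_def)
  qed
  have inj: "inj_on (\<lambda>i. w (g i)) {1..}"
  proof (rule inj_on_order[where n = n and e = e])
    fix i :: nat assume i: "1 \<le> i"
    show "w (g i) = int n - int i + e i" by (simp add: e_def)
    show "\<exists>a b. t * g i = \<kappa> a * g i + \<kappa> b * g (i + 1) + g (i + 2)"
    proof -
      \<comment> \<open>The relation is padded to four terms; the coefficients 1 and 0 are unchanged
        by the powers \<open>q ^ j\<close>.\<close>
      have "t * g k = \<kappa> \<theta> * g k + \<kappa> (a k) * g (k + 1) + \<kappa> 1 * g (k + 2) + \<kappa> 0 * g (k + 3)"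
        if "1 \<le> k" "k \<le> n" for k
        using assms(22)[OF that] by simp
      from relation_shift[OF i this F.tw_t] obtain j k where
        "t * g i = \<kappa> (\<theta> ^ q ^ j) * g i + \<kappa> (a k ^ q ^ j) * g (i + 1) +
          \<kappa> (1 ^ q ^ j) * g (i + 2) + \<kappa> (0 ^ q ^ j) * g (i + 3)" by blast
      then have "t * g i = \<kappa> (\<theta> ^ q ^ j) * g i + \<kappa> (a k ^ q ^ j) * g (i + 1) + g (i + 2)"
        using q by (simp add: power_0_left del: \<kappa>.hom_power)
      then show ?thesis by blast
    qed
    show "\<exists>a b c. y * g i = \<kappa> a * g i + \<kappa> b * g (i + 1) + \<kappa> c * g (i + 2) + g (i + 3)"
    proof -
      have "y * g k = \<kappa> \<eta> * g k + \<kappa> (yc k) * g (k + 1) + \<kappa> (zc k) * g (k + 2) + \<kappa> 1 * g (k + 3)"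
        if "1 \<le> k" "k \<le> n" for k
        using assms(23)[OF that] by simp
      from relation_shift[OF i this F.tw_y] show ?thesis by (auto simp del: \<kappa>.hom_power)
    qed
  qed (use n g_nz e_cases e_period in auto)
  \<comment> \<open>As \<open>s < n\<close>, the index \<open>i * n + s + 1\<close> determines the
    pair, so distinct pairs give distinct orders.\<close>
  have indep: "c (i, s) = 0" if J: "finite J" "J \<subseteq> UNIV \<times> {..<n}"
      "(\<Sum>(i, s)\<in>J. \<kappa> (c (i, s)) * g (i * n + s + 1)) = 0" "(i, s) \<in> J" for J c i s
  proof (rule independent_of_distinct_orders[OF J(1), of "\<lambda>(i, s). g (i * n + s + 1)"])
    show "inj_on (\<lambda>j. w (case j of (i, s) \<Rightarrow> g (i * n + s + 1))) J"
    proof (rule inj_onI, clarify)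
      fix i s i' s' assume m: "(i, s) \<in> J" "(i', s') \<in> J" and "w (g (i * n + s + 1)) = w (g (i' * n + s' + 1))"
      then have eq: "i * n + s = i' * n + s'" using inj by (auto dest!: inj_onD)
      moreover have "s < n" "s' < n" using m J(2) by auto
      ultimately show "i = i' \<and> s = s'"
        by (metis add.commute div_mult_self1 div_less mod_mult_self1 mod_less add_0 n neq0_conv)
    qed
  qed (use J g_nz in \<open>auto simp: case_prod_unfold\<close>)

  define \<rho> where "\<rho> = rho_tensor q Fq \<theta> \<eta> \<kappa> t y n a yc zc"
  have Pt: "represents H (rho_t n \<theta> a) t \<theta>"
    using assms(21,22) by (intro represents_rho_t[OF assms(1) H \<theta>H] F.tw_t) auto
  have Py: "represents H (rho_y n \<eta> yc zc) y \<eta>"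
    using assms(21,23) by (intro represents_rho_y[OF assms(1) H \<eta>H] F.tw_y) auto
  \<comment> \<open>Elements of A have coordinates with coefficients in \<open>Fq\<close>, which the
    \<open>q\<close>-th power fixes; \<open>\<rho>\<close> and \<open>iota\<close> are built from
    them by sums and products, which \<open>represents\<close> respects.\<close>
  have rep: "represents H (\<rho> b) b (iota Fq \<theta> \<eta> \<kappa> t y b)" if b: "b \<in> A_ring Fq \<kappa> t y" for b
  proof -
    obtain c d where bcd: "b = rf c d" and cd: "set (coeffs c) \<subseteq> Fq" "set (coeffs d) \<subseteq> Fq"
      using A_ring_subset_regular_over[OF Fq B.E_over_Fq] b by (auto simp: regular_over_def)
    have coords: "A_coords Fq \<kappa> t y b = (c, d)" unfolding bcd by (rule A_coords_rf[OF cd])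
    have coeff: "coeff p i \<in> Fq" if "set (coeffs p) \<subseteq> Fq" for p i
      using that range_coeff[of p] subring_univ_fieldD(1)[OF Fq] by (metis insert_subset range_subsetD)
    have frob: "x ^ q = x" if "x \<in> Fq" for x
      using finite_subfield_frobenius[OF B.Fq_subfield B.Fq_finite that] B.Fq_card by simp
    have poly: "represents H (poly_in_tp q n p (rho_t n \<theta> a)) (poly (map_poly \<kappa> p) t) (poly p \<theta>)"
      if "set (coeffs p) \<subseteq> Fq" for p
      using coeff[OF that] FqH frob by (intro represents_poly_in_tp[OF H Pt]) auto
    show ?thesis
      using represents_add[OF H poly[OF cd(1)] represents_mult[OF H Py poly[OF cd(2)]]]
      by (simp add: \<rho>_def rho_tensor_def iota_def coords Let_def) (simp add: bcd regular_fun_def)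
  qed
  have unique: "P = Q" if "represents H P b x" "represents H Q b x'" for P Q b x x'
    by (rule represents_unique[OF _ that]) (erule (3) indep)

  have cl: "b \<in> A_ring Fq \<kappa> t y \<Longrightarrow> b' \<in> A_ring Fq \<kappa> t y \<Longrightarrow> b * b' \<in> A_ring Fq \<kappa> t y"
    "b \<in> A_ring Fq \<kappa> t y \<Longrightarrow> b' \<in> A_ring Fq \<kappa> t y \<Longrightarrow> b + b' \<in> A_ring Fq \<kappa> t y"
    "1 \<in> A_ring Fq \<kappa> t y" "c \<in> Fq \<Longrightarrow> \<kappa> c \<in> A_ring Fq \<kappa> t y" for b b' c
    unfolding A_ring_def
    using generate_ring.eng_mult[of b univ_field _ b'] generate_ring.eng_add[of b univ_field _ b']
      generate_ring.one[of univ_field] by (auto intro: generate_ring.incl)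
  \<comment> \<open>Each homomorphism law holds because its two sides represent the same
    function.\<close>
  have "\<rho> \<in> Ring.ring_hom (restrict_ring (A_ring Fq \<kappa> t y)) R"
  proof (rule ring_hom_memI)
    show "\<rho> \<one>\<^bsub>restrict_ring (A_ring Fq \<kappa> t y)\<^esub> = \<one>\<^bsub>R\<^esub>"
      using unique[OF rep[OF cl(3)] represents_one[OF H]] by simp
    show "\<rho> b \<in> carrier R" if "b \<in> carrier (restrict_ring (A_ring Fq \<kappa> t y))" for b
      using that represents_carrier_UNIV[OF rep] by simp
  next
    fix b b' assume "b \<in> carrier (restrict_ring (A_ring Fq \<kappa> t y))" "b' \<in> carrier (restrict_ring (A_ring Fq \<kappa> t y))"
    then have b: "b \<in> A_ring Fq \<kappa> t y" and b': "b' \<in> A_ring Fq \<kappa> t y" by auto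
    show "\<rho> (b \<otimes>\<^bsub>restrict_ring (A_ring Fq \<kappa> t y)\<^esub> b') = \<rho> b \<otimes>\<^bsub>R\<^esub> \<rho> b'"
      using unique[OF rep[OF cl(1)[OF b b']] represents_mult[OF H rep[OF b] rep[OF b']]] by simp
    show "\<rho> (b \<oplus>\<^bsub>restrict_ring (A_ring Fq \<kappa> t y)\<^esub> b') = \<rho> b \<oplus>\<^bsub>R\<^esub> \<rho> b'"
      using unique[OF rep[OF cl(2)[OF b b']] represents_add[OF H rep[OF b] rep[OF b']]] by simp
  qed
  moreover have "\<rho> (\<kappa> c) = scalar_tp n c" if c: "c \<in> Fq" for c
    using unique[OF rep[OF cl(4)[OF c]] represents_scalar[OF H]] c FqH
      finite_subfield_frobenius[OF B.Fq_subfield B.Fq_finite c] B.Fq_card by auto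
  moreover have "\<exists>N. nilpotent_mat n N \<and> \<rho> b 0 = iota Fq \<theta> \<eta> \<kappa> t y b \<cdot>\<^sub>m 1\<^sub>m n + N"
    if b: "b \<in> A_ring Fq \<kappa> t y" for b
  proof -
    let ?x = "iota Fq \<theta> \<eta> \<kappa> t y b"
    \<comment> \<open>Since \<open>\<rho> b 0\<close> is upper triangular with diagonal
      \<open>?x\<close>, the remainder is strictly upper triangular.\<close>
    define N where "N = \<rho> b 0 - ?x \<cdot>\<^sub>m 1\<^sub>m n"
    have m: "\<rho> b 0 \<in> carrier_mat n n" and
      u: "\<And>r s. r < n \<Longrightarrow> s \<le> r \<Longrightarrow> \<rho> b 0 $$ (r, s) = (if s = r then ?x else 0)"
      using rep[OF b] by (auto simp: represents_def carrier_twisted_poly_ring_iff)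
    have "nilpotent_mat n N"
      by (rule nilpotent_strict_upper) (use m u in \<open>auto simp: N_def\<close>)
    moreover have "\<rho> b 0 = ?x \<cdot>\<^sub>m 1\<^sub>m n + N"
      by (rule eq_matI) (use m in \<open>auto simp: N_def\<close>)
    ultimately show ?thesis by blast
  qed
  moreover have "\<rho> ` A_ring Fq \<kappa> t y \<subseteq> carrier (twisted_poly_ring q n H)"
    using rep by (auto simp: represents_def)
  ultimately show ?thesis unfolding anderson_module_def \<rho>_def by blast
qed

end
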